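(* Let $x,y,z,w$ be quaternion-valued indeterminates. The real-valued quartic homogeneous polynomial $$(|x|^2+|y|^2)(|z|^2+|w|^2)-|xz^*+yw^*|^2,$$ in $16$ real variables (the real components of $x,y,z,w$), is not a sum of hyperwrons, i.e., it cannot be written as a finite sum of hyperwrons of degree $4$ in $16$ variables.
   Context: For a quaternion $x=a+bi+cj+dk$ (with $a,b,c,d$ real), $x^*=a-bi-cj-dk$ is its conjugate and $|x|^2=xx^*=x^*x=a^2+b^2+c^2+d^2$. $F_{m,k}$ denotes the real vector space of homogeneous polynomials (forms) of degree $k$ in $m$ real variables with real coefficients (including $0$). A form $p\in F_{n,d}$ is hyperbolic with respect to $e\in\mathbb{R}^n$ if $p(e)>0$ and for every $x\in\mathbb{R}^n$ the univariate polynomial $t\mapsto p(te-x)$ has only real roots; $\mathrm{Hyp}_{n,d}(e)$ is the set of such $p$. The associated (closed) hyperbolicity cone $\Lambda_+(p,e)$ is the set of $x\in\mathbb{R}^n$ such that all roots of $t\mapsto p(te-x)$ are non-negative. $D_ap(x)=\frac{d}{dt}p(x+ta)|_{t=0}$ is the directional derivative and $D^2_{ab}p=D_aD_bp$. $F_{m,k}^n$ is the set of $n$-tuples of elements of $F_{m,k}$, viewed as polynomial maps $\mathbb{R}^m\to\mathbb{R}^n$. A form $q\in F_{m,2y}$ is a hyperwron if there exist positive integers $k,d,n$, a vector $e\in\mathbb{R}^n$, a hyperbolic polynomial $p\in\mathrm{Hyp}_{n,d}(e)$, points $u,v\in\Lambda_+(p,e)$ and a map $\phi\in F_{m,k}^n$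 such that $$q(x)=D_up(\phi(x))\,D_vp(\phi(x))-p(\phi(x))\,D^2_{uv}p(\phi(x)).$$ *)

theory Defs
  imports "HOL-Analysis.Analysis" "HOL-Library.Poly_Mapping" "HOL-Library.Nonpos_Ints"
begin

section \<open>Forms\<close>

text \<open>A monomial is a finitely supported exponent vector; the indeterminates are indexed by
  natural numbers.\<close>

type_synonym real_mpoly = "(nat \<Rightarrow>\<^sub>0 nat) \<Rightarrow>\<^sub>0 real"

definition Var :: "nat \<Rightarrow> real_mpoly" where
  "Var i = Poly_Mapping.single (Poly_Mapping.single i 1) 1"

definition mdegree :: "(nat \<Rightarrow>\<^sub>0 nat) \<Rightarrow> nat" where
  "mdegree \<alpha> = (\<Sum>i\<in>Poly_Mapping.keys \<alpha>. Poly_Mapping.lookup \<alpha> i)"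

definition forms :: "nat \<Rightarrow> nat \<Rightarrow> real_mpoly set" where
  "forms m k = {p. \<forall>\<alpha>\<in>Poly_Mapping.keys p. Poly_Mapping.keys \<alpha> \<subseteq> {..<m} \<and> mdegree \<alpha> = k}"

text \<open>Evaluation is polymorphic so that real polynomials can also be evaluated at complex
  points.\<close>

definition eval :: "real_mpoly \<Rightarrow> (nat \<Rightarrow> 'a::{real_algebra_1,comm_ring_1}) \<Rightarrow> 'a" where
  "eval p x = (\<Sum>\<alpha>\<in>Poly_Mapping.keys p. of_real (Poly_Mapping.lookup p \<alpha>) *
     (\<Prod>i\<in>Poly_Mapping.keys \<alpha>. x i ^ Poly_Mapping.lookup \<alpha> i))"

text \<open>The space \<open>\<real>\<^sup>n\<close> with coordinates \<open>x 0, \<dots>, x (n - 1)\<close>, as functions vanishing beyond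
  these (the dimension has to be quantified over, so it cannot be a type).\<close>

definition vecs :: "nat \<Rightarrow> (nat \<Rightarrow> real) set" where
  "vecs n = {x. \<forall>i\<ge>n. x i = 0}"

text \<open>\<open>n\<close>-tuples of forms, padded with zero polynomials so that they map into \<^term>\<open>vecs n\<close>.\<close>

definition form_maps :: "nat \<Rightarrow> nat \<Rightarrow> nat \<Rightarrow> (nat \<Rightarrow> real_mpoly) set" where
  "form_maps m k n = {\<phi>. (\<forall>i<n. \<phi> i \<in> forms m k) \<and> (\<forall>i\<ge>n. \<phi> i = 0)}"

definition eval_map :: "(nat \<Rightarrow> real_mpoly) \<Rightarrow> (nat \<Rightarrow> real) \<Rightarrow> (nat \<Rightarrow> real)" where
  "eval_map \<phi> x = (\<lambda>i. eval (\<phi> i) x)"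

definition dir_deriv :: "(nat \<Rightarrow> real) \<Rightarrow> ((nat \<Rightarrow> real) \<Rightarrow> real) \<Rightarrow> (nat \<Rightarrow> real) \<Rightarrow> real" where
  "dir_deriv a f x = deriv (\<lambda>t. f (\<lambda>i. x i + t * a i)) 0"

section \<open>Hyperbolic polynomials\<close>

text \<open>The roots of the univariate polynomial \<open>p(te - x)\<close> in \<open>t\<close> are taken in \<open>\<complex>\<close>; neither real-rootedness
  nor non-negativity of the roots is about real roots only.\<close>

definition roots_along :: "real_mpoly \<Rightarrow> (nat \<Rightarrow> real) \<Rightarrow> (nat \<Rightarrow> real) \<Rightarrow> complex set" where
  "roots_along p e x = {t. eval p (\<lambda>i. t * of_real (e i) - of_real (x i)) = 0}"

definition hyperbolic :: "nat \<Rightarrow> nat \<Rightarrow> (nat \<Rightarrow> real) \<Rightarrow> real_mpoly set" where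
  "hyperbolic n d e =
     {p \<in> forms n d. eval p e > 0 \<and> (\<forall>x\<in>vecs n. roots_along p e x \<subseteq> \<real>)}"

definition hyp_cone :: "nat \<Rightarrow> real_mpoly \<Rightarrow> (nat \<Rightarrow> real) \<Rightarrow> (nat \<Rightarrow> real) set" where
  "hyp_cone n p e = {x \<in> vecs n. roots_along p e x \<subseteq> \<real>\<^sub>\<ge>\<^sub>0}"

text \<open>The parameter \<open>y\<close> is half the degree: these are the hyperwrons in \<^term>\<open>forms m (2 * y)\<close>.\<close>

definition hyperwrons :: "nat \<Rightarrow> nat \<Rightarrow> real_mpoly set" where
  "hyperwrons m y = {q \<in> forms m (2 * y).
     \<exists>k>0. \<exists>d>0. \<exists>n>0. \<exists>e\<in>vecs n. \<exists>p\<in>hyperbolic n d e.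
     \<exists>u\<in>hyp_cone n p e. \<exists>v\<in>hyp_cone n p e. \<exists>\<phi>\<in>form_maps m k n.
     \<forall>x\<in>vecs m. eval q x =
       dir_deriv u (eval p) (eval_map \<phi> x) * dir_deriv v (eval p) (eval_map \<phi> x)
       - eval p (eval_map \<phi> x) * dir_deriv u (dir_deriv v (eval p)) (eval_map \<phi> x)}"

section \<open>Quaternions\<close>

text \<open>\<open>Quat a b c d\<close> is \<open>a + b i + c j + d k\<close>. The components may lie in any ring;
  quaternion-valued indeterminates have components in \<^typ>\<open>real_mpoly\<close>.\<close>

datatype 'a quat = Quat 'a 'a 'a 'a

instantiation quat :: (plus) plus
begin
fun plus_quat :: "'a quat \<Rightarrow> 'a quat \<Rightarrow> 'a quat" where
  "Quat a b c d + Quat a' b' c' d' = Quat (a + a') (b + b') (c + c') (d + d')"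
instance ..
end

instantiation quat :: (ring) times
begin
fun times_quat :: "'a quat \<Rightarrow> 'a quat \<Rightarrow> 'a quat" where
  "Quat a b c d * Quat a' b' c' d' =
     Quat (a * a' - b * b' - c * c' - d * d')
          (a * b' + b * a' + c * d' - d * c')
          (a * c' - b * d' + c * a' + d * b')
          (a * d' + b * c' - c * b' + d * a')"
instance ..
end

fun qconj :: "'a::ring quat \<Rightarrow> 'a quat" where
  "qconj (Quat a b c d) = Quat a (- b) (- c) (- d)"

fun qnorm2 :: "'a::comm_ring_1 quat \<Rightarrow> 'a" where
  "qnorm2 (Quat a b c d) = a\<^sup>2 + b\<^sup>2 + c\<^sup>2 + d\<^sup>2"

lemma quat_mult_qconj: "x * qconj x = Quat (qnorm2 x) 0 0 0" "qconj x * x = Quat (qnorm2 x) 0 0 0"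
  for x :: "'a::comm_ring_1 quat"
  by (cases x; simp add: power2_eq_square algebra_simps)+

text \<open>The quaternion indeterminate with components the real indeterminates
  \<open>4 * j, \<dots>, 4 * j + 3\<close>.\<close>

definition quat_var :: "nat \<Rightarrow> real_mpoly quat" where
  "quat_var j = Quat (Var (4 * j)) (Var (4 * j + 1)) (Var (4 * j + 2)) (Var (4 * j + 3))"

end

theory Submission
  imports Defs "HOL-Computational_Algebra.Fundamental_Theorem_Algebra"
begin

text \<open>
  Arrange \<open>x, y, z, w\<close> as a quaternionic matrix \<open>M\<close> with rows \<open>(x, y)\<close> and \<open>(z, w)\<close>. The quartic \<open>Q\<close> is
  then the Gram determinant of the two rows, which is non-negative and vanishes exactly when the
  rows are linearly dependent over the quaternions. Three facts together exclude a
  decomposition of \<open>Q\<close> into hyperwrons.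

  First, hyperwrons are non-negative (\<open>Rayleigh_inequality\<close>). A hyperbolic polynomial \<open>p\<close> has no zero
  \<open>x + s u + t v + i\<beta> e\<close> with \<open>x\<close> real, \<open>\<beta> > 0\<close>, \<open>s\<close> and \<open>t\<close> in the closed upper half plane and \<open>u\<close>, \<open>v\<close> in the
  cone (\<open>hyperbolic_stable\<close>); this is Garding's theorem, shown by a deformation during which the
  zeros of a univariate polynomial cannot cross the real axis. Therefore \<open>D\<^sub>v p / p\<close> maps the upper
  half plane along the direction \<open>u\<close> into the closed lower half plane, and its derivative at the
  real point \<open>x\<close>, which has the sign of \<open>p D\<^sub>u D\<^sub>v p - D\<^sub>u p D\<^sub>v p\<close>, is at most zero.

  Second, \<open>Q\<close> spans an extreme ray of the cone of non-negative quartics (\<open>qdet_extremal\<close>). If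
  \<open>0 \<le> h \<le> K Q\<close> then \<open>h\<close> is bounded along every line \<open>\<tau> \<mapsto> M + \<tau> N\<close> along which \<open>Q\<close> is constant, and a bounded
  polynomial is constant. Adding \<open>\<tau> c\<close> times one row to the other row is such a line, so \<open>h\<close> is
  invariant under row operations. These act transitively enough to turn \<open>M\<close> into a real multiple of
  the identity matrix whenever \<open>Q\<close> does not vanish at \<open>M\<close>, because every unit quaternion is a
  commutator. By homogeneity, \<open>h\<close> is a multiple of \<open>Q\<close>. Applied to the summands of
  a decomposition of \<open>Q\<close>, this makes each of them a multiple of \<open>Q\<close>, and some multiple is not zero.

  Third, \<open>Q\<close> does not become a product of two quadratic forms on any hyperplane
  (\<open>qdet_not_product_on_hyperplane\<close>). This is what a non-zero hyperwron equal to \<open>c Q\<close> would give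
  (\<open>hyperwron_structure\<close>): comparing degrees, \<open>k (d - 1) = 2\<close>. If \<open>d = 3\<close> and \<open>k = 1\<close>, the hyperwron is
  \<open>B C - A D\<close> with quadratic forms \<open>B\<close>, \<open>C\<close> and a linear form \<open>D\<close>, so \<open>c Q = B C\<close> where \<open>D\<close> vanishes. If \<open>d = 2\<close>
  and \<open>k = 2\<close>, it is a positive semidefinite quadratic form evaluated at \<open>\<phi>\<close>, and the Cauchy-Schwarz inequality
  bounds the square of some quadratic form by a multiple of it; extremality, applied to this
  square, makes \<open>Q\<close> itself a multiple of a square.
\<close>

section \<open>Evaluation of polynomials\<close>

definition monom_val :: "(nat \<Rightarrow> 'a::comm_ring_1) \<Rightarrow> (nat \<Rightarrow>\<^sub>0 nat) \<Rightarrow> 'a" where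
  "monom_val x \<alpha> = (\<Prod>i\<in>Poly_Mapping.keys \<alpha>. x i ^ Poly_Mapping.lookup \<alpha> i)"

lemma monom_val_superset:
  assumes "finite K" "Poly_Mapping.keys \<alpha> \<subseteq> K"
  shows "monom_val x \<alpha> = (\<Prod>i\<in>K. x i ^ Poly_Mapping.lookup \<alpha> i)"
  unfolding monom_val_def
  by (rule prod.mono_neutral_left) (use assms in \<open>auto simp: not_in_keys_iff_lookup_eq_zero\<close>)

lemma monom_val_add: "monom_val x (\<alpha> + \<beta>) = monom_val x \<alpha> * monom_val x \<beta>"
proof -
  let ?K = "Poly_Mapping.keys \<alpha> \<union> Poly_Mapping.keys \<beta>"
  have "Poly_Mapping.keys (\<alpha> + \<beta>) \<subseteq> ?K"
    by (rule Poly_Mapping.keys_add)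
  then show ?thesis
    by (simp add: monom_val_superset[of ?K] lookup_add power_add prod.distrib)
qed

lemma eval_superset:
  assumes "finite K" "Poly_Mapping.keys p \<subseteq> K"
  shows "eval p x = (\<Sum>\<alpha>\<in>K. of_real (Poly_Mapping.lookup p \<alpha>) * monom_val x \<alpha>)"
  unfolding eval_def monom_val_def
  by (rule sum.mono_neutral_left) (use assms in \<open>auto simp: not_in_keys_iff_lookup_eq_zero\<close>)

lemma eval_zero [simp]: "eval 0 x = 0"
  by (simp add: eval_def)

lemma eval_single: "eval (Poly_Mapping.single \<alpha> c) x = of_real c * monom_val x \<alpha>"
  by (simp add: eval_superset[of "{\<alpha>}"])

lemma eval_add [simp]: "eval (p + q) x = eval p x + eval q x"
proof -
  let ?K = "Poly_Mapping.keys p \<union> Poly_Mapping.keys q"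
  have "Poly_Mapping.keys (p + q) \<subseteq> ?K"
    by (rule Poly_Mapping.keys_add)
  then show ?thesis
    by (simp add: eval_superset[of ?K] lookup_add sum.distrib algebra_simps)
qed

lemma eval_uminus [simp]: "eval (- p) x = - eval p x"
  using eval_add[of p "- p" x] by (simp add: eq_neg_iff_add_eq_0 add.commute)

lemma eval_diff [simp]: "eval (p - q) x = eval p x - eval q x"
  using eval_add[of p "- q" x] by simp

lemma eval_sum: "eval (\<Sum>j\<in>A. p j) x = (\<Sum>j\<in>A. eval (p j) x)"
  by (induction A rule: infinite_finite_induct) auto

lemma eval_Var [simp]: "eval (Var i) x = x i"
  by (simp add: Var_def eval_single monom_val_def)

lemma mpoly_eq_sum_single:
  "p = (\<Sum>\<alpha>\<in>Poly_Mapping.keys p. Poly_Mapping.single \<alpha> (Poly_Mapping.lookup p \<alpha>))"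
  by (rule poly_mapping_eqI) (auto simp: lookup_sum lookup_single when_def not_in_keys_iff_lookup_eq_zero)

lemma eval_mult [simp]: "eval (p * q) x = eval p x * eval q x"
proof -
  have *: "eval (Poly_Mapping.single \<alpha> a * Poly_Mapping.single \<beta> b) x
      = eval (Poly_Mapping.single \<alpha> a) x * eval (Poly_Mapping.single \<beta> b) x" for \<alpha> \<beta> a b
    by (simp add: mult_single eval_single monom_val_add algebra_simps)
  have "p * q = (\<Sum>\<alpha>\<in>Poly_Mapping.keys p. \<Sum>\<beta>\<in>Poly_Mapping.keys q.
      Poly_Mapping.single \<alpha> (Poly_Mapping.lookup p \<alpha>) * Poly_Mapping.single \<beta> (Poly_Mapping.lookup q \<beta>))"
    by (subst mpoly_eq_sum_single[of p], subst mpoly_eq_sum_single[of q]) (simp add: sum_product)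
  then have "eval (p * q) x = (\<Sum>\<alpha>\<in>Poly_Mapping.keys p. \<Sum>\<beta>\<in>Poly_Mapping.keys q.
      eval (Poly_Mapping.single \<alpha> (Poly_Mapping.lookup p \<alpha>)) x * eval (Poly_Mapping.single \<beta> (Poly_Mapping.lookup q \<beta>)) x)"
    by (simp add: eval_sum *)
  also have "\<dots> = eval p x * eval q x"
    by (simp only: eval_single, simp add: sum_product eval_superset[of "Poly_Mapping.keys p" p] eval_superset[of "Poly_Mapping.keys q" q])
  finally show ?thesis .
qed

section \<open>Forms as functions\<close>

text \<open>
  A form of degree \<open>k\<close> enters the argument only through the functions that it induces on
  real and on complex points, and these are tracked together as a pair: the real function carries
  the inequalities, the complex one the location of zeros. As the functions are generated by constants and
  coordinates, closure under composition and directional derivatives is an induction.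
  The zero form has every degree.
\<close>
inductive form_fun :: "nat \<Rightarrow> ((nat \<Rightarrow> real) \<Rightarrow> real) \<Rightarrow> ((nat \<Rightarrow> complex) \<Rightarrow> complex) \<Rightarrow> bool" where
  zero: "form_fun k (\<lambda>x. 0) (\<lambda>z. 0)"
| const: "form_fun 0 (\<lambda>x. c) (\<lambda>z. of_real c)"
| coord: "form_fun 1 (\<lambda>x. x i) (\<lambda>z. z i)"
| add: "form_fun k f F \<Longrightarrow> form_fun k g G \<Longrightarrow> form_fun k (\<lambda>x. f x + g x) (\<lambda>z. F z + G z)"
| mult: "form_fun k f F \<Longrightarrow> form_fun l g G \<Longrightarrow> form_fun (k + l) (\<lambda>x. f x * g x) (\<lambda>z. F z * G z)"

lemma form_fun_sum:
  assumes "\<And>j. j \<in> A \<Longrightarrow> form_fun k (f j) (F j)"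
  shows "form_fun k (\<lambda>x. \<Sum>j\<in>A. f j x) (\<lambda>z. \<Sum>j\<in>A. F j z)"
  using assms
  by (induction A rule: infinite_finite_induct) (auto intro: form_fun.intros)

lemma form_fun_power:
  assumes "form_fun k f F"
  shows "form_fun (k * n) (\<lambda>x. f x ^ n) (\<lambda>z. F z ^ n)"
proof (induction n)
  case 0
  show ?case using const[of 1] by simp
next
  case (Suc n)
  show ?case using mult[OF assms Suc.IH] by simp
qed

lemma form_fun_prod:
  assumes "finite A" "\<And>j. j \<in> A \<Longrightarrow> form_fun (k j) (f j) (F j)"
  shows "form_fun (\<Sum>j\<in>A. k j) (\<lambda>x. \<Prod>j\<in>A. f j x) (\<lambda>z. \<Prod>j\<in>A. F j z)"
  using assms
proof (induction A)
  case empty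
  show ?case using const[of 1] by simp
next
  case (insert j A)
  then show ?case by (auto intro!: mult)
qed

lemma form_fun_eval:
  assumes "p \<in> forms m k"
  shows "form_fun k (eval p) (eval p)"
proof -
  have "form_fun k (\<lambda>x. of_real (Poly_Mapping.lookup p \<alpha>) * (\<Prod>i\<in>Poly_Mapping.keys \<alpha>. x i ^ Poly_Mapping.lookup \<alpha> i))
      (\<lambda>z. of_real (Poly_Mapping.lookup p \<alpha>) * (\<Prod>i\<in>Poly_Mapping.keys \<alpha>. z i ^ Poly_Mapping.lookup \<alpha> i))"
    if "\<alpha> \<in> Poly_Mapping.keys p" for \<alpha>
  proof -
    have "form_fun (\<Sum>i\<in>Poly_Mapping.keys \<alpha>. 1 * Poly_Mapping.lookup \<alpha> i)
      (\<lambda>x. \<Prod>i\<in>Poly_Mapping.keys \<alpha>. x i ^ Poly_Mapping.lookup \<alpha> i)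
      (\<lambda>z. \<Prod>i\<in>Poly_Mapping.keys \<alpha>. z i ^ Poly_Mapping.lookup \<alpha> i)"
      by (intro form_fun_prod form_fun_power coord) auto
    moreover have "(\<Sum>i\<in>Poly_Mapping.keys \<alpha>. 1 * Poly_Mapping.lookup \<alpha> i) = k"
      using assms that by (auto simp: forms_def mdegree_def)
    ultimately show ?thesis
      using mult[OF const] by fastforce
  qed
  then show ?thesis
    unfolding eval_def[abs_def] by (rule form_fun_sum)
qed

lemma form_fun_comp:
  assumes "form_fun d f F" and "\<And>i. form_fun k (\<lambda>x. \<phi> x i) (\<lambda>z. \<Phi> z i)"
  shows "form_fun (k * d) (\<lambda>x. f (\<phi> x)) (\<lambda>z. F (\<Phi> z))"
  using assms(1)
proof induction
  case (mult k f F l g G)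
  then show ?case by (auto simp: distrib_left intro: form_fun.mult)
qed (use assms(2) in \<open>auto intro: form_fun.intros\<close>)

lemma form_fun_homogeneous:
  assumes "form_fun k f F"
  shows "f (\<lambda>i. c * x i) = c ^ k * f x" "F (\<lambda>i. b * z i) = b ^ k * F z"
  using assms by (induction) (auto simp: algebra_simps power_add)

lemma form_fun_of_real:
  assumes "form_fun k f F"
  shows "F (\<lambda>i. of_real (x i)) = of_real (f x)"
  using assms by induction auto

lemma form_fun_real_line:
  assumes "form_fun k f F"
  obtains q where "\<And>t. f (\<lambda>i. a i + t * b i) = poly q t"
proof -
  have "\<exists>q. \<forall>t. f (\<lambda>i. a i + t * b i) = poly q t"
    using assms
  proof induction
    case (zero k)
    show ?case by (intro exI[of _ 0]) auto
  next
    case (const c)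
    show ?case by (intro exI[of _ "[:c:]"]) auto
  next
    case (coord i)
    show ?case by (intro exI[of _ "[:a i, b i:]"]) auto
  next
    case (add k f F g G)
    then show ?case by (metis poly_add)
  next
    case (mult k f F l g G)
    then show ?case by (metis poly_mult)
  qed
  with that show ?thesis by blast
qed

text \<open>
  By homogeneity the coefficient of \<open>t ^ k\<close> is the value at the direction of the line. It is recorded because it
  decides whether the restriction to the line loses degree.
\<close>
lemma form_fun_complex_line:
  assumes "form_fun k f F"
  obtains q where "\<And>t. F (\<lambda>i. a i + t * b i) = poly q t" "degree q \<le> k" "coeff q k = F b"
proof -
  have "\<exists>q. (\<forall>t. F (\<lambda>i. a i + t * b i) = poly q t) \<and> degree q \<le> k \<and> coeff q k = F b"
    using assms
  proof induction
    case (zero k)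
    show ?case by (intro exI[of _ 0]) auto
  next
    case (const c)
    show ?case by (intro exI[of _ "[:of_real c:]"]) auto
  next
    case (coord i)
    show ?case by (intro exI[of _ "[:a i, b i:]"]) (auto simp: degree_pCons_eq_if)
  next
    case (add k f F g G)
    then obtain p q where "\<forall>t. F (\<lambda>i. a i + t * b i) = poly p t" "degree p \<le> k" "coeff p k = F b"
      "\<forall>t. G (\<lambda>i. a i + t * b i) = poly q t" "degree q \<le> k" "coeff q k = G b"
      by blast
    then show ?case
      by (intro exI[of _ "p + q"]) (auto intro: degree_add_le)
  next
    case (mult k f F l g G)
    then obtain p q where pq: "\<forall>t. F (\<lambda>i. a i + t * b i) = poly p t" "degree p \<le> k" "coeff p k = F b"
      "\<forall>t. G (\<lambda>i. a i + t * b i) = poly q t" "degree q \<le> l" "coeff q l = G b"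
      by blast
    have "coeff (p * q) (k + l) = coeff p k * coeff q l"
    proof -
      have "coeff (p * q) (k + l) = (\<Sum>i\<le>k + l. coeff p i * coeff q (k + l - i))"
        by (simp add: coeff_mult)
      also have "\<dots> = (\<Sum>i\<in>{k}. coeff p i * coeff q (k + l - i))"
      proof (rule sum.mono_neutral_right)
        show "\<forall>i\<in>{..k + l} - {k}. coeff p i * coeff q (k + l - i) = 0"
        proof
          fix i assume "i \<in> {..k + l} - {k}"
          then have "i > k \<or> k + l - i > l" by auto
          then show "coeff p i * coeff q (k + l - i) = 0"
            using pq by (auto simp: coeff_eq_0)
        qed
      qed auto
      finally show ?thesis by simp
    qed
    moreover have "degree (p * q) \<le> k + l"
      using degree_mult_le[of p q] pq by linarith
    ultimately show ?case
      using pq by (intro exI[of _ "p * q"]) auto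
  qed
  with that show ?thesis by blast
qed

lemma form_fun_continuous:
  assumes "form_fun k f F" and "\<And>i. continuous_on S (\<lambda>s. w s i)"
  shows "continuous_on S (\<lambda>s. F (w s))"
  using assms(1) by induction (auto intro!: continuous_intros assms(2))

definition cdir_deriv :: "(nat \<Rightarrow> real) \<Rightarrow> ((nat \<Rightarrow> complex) \<Rightarrow> complex) \<Rightarrow> (nat \<Rightarrow> complex) \<Rightarrow> complex" where
  "cdir_deriv a F z = deriv (\<lambda>t. F (\<lambda>i. z i + t * of_real (a i))) 0"

text \<open>
  Degree \<open>0\<close> is singled out since \<open>k - 1\<close> truncates there: constants must be known to have derivative
  zero for the product rule to respect degrees.
\<close>
lemma form_fun_dir_deriv_aux:
  assumes "form_fun k f F"
  shows "\<exists>f' F'. form_fun (k - 1) f' F' \<and> (k = 0 \<longrightarrow> f' = (\<lambda>x. 0) \<and> F' = (\<lambda>z. 0)) \<and>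
    (\<forall>x. ((\<lambda>t. f (\<lambda>i. x i + t * a i)) has_field_derivative f' x) (at 0)) \<and>
    (\<forall>z. ((\<lambda>t. F (\<lambda>i. z i + t * of_real (a i))) has_field_derivative F' z) (at 0))"
  using assms
proof induction
  case (zero k)
  show ?case
    by (intro exI[of _ "\<lambda>x. 0"] conjI form_fun.zero) auto
next
  case (const c)
  show ?case
    by (intro exI[of _ "\<lambda>x. 0"] conjI form_fun.zero) auto
next
  case (coord i)
  show ?case
    by (intro exI[of _ "\<lambda>x. a i"] exI[of _ "\<lambda>x. of_real (a i)"] conjI)
      (auto intro!: form_fun.const derivative_eq_intros)
next
  case (add k f F g G)
  then obtain f' F' g' G' where
    "form_fun (k - 1) f' F'" "k = 0 \<longrightarrow> f' = (\<lambda>x. 0) \<and> F' = (\<lambda>z. 0)"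
    "\<forall>x. ((\<lambda>t. f (\<lambda>i. x i + t * a i)) has_field_derivative f' x) (at 0)"
    "\<forall>z. ((\<lambda>t. F (\<lambda>i. z i + t * of_real (a i))) has_field_derivative F' z) (at 0)"
    "form_fun (k - 1) g' G'" "k = 0 \<longrightarrow> g' = (\<lambda>x. 0) \<and> G' = (\<lambda>z. 0)"
    "\<forall>x. ((\<lambda>t. g (\<lambda>i. x i + t * a i)) has_field_derivative g' x) (at 0)"
    "\<forall>z. ((\<lambda>t. G (\<lambda>i. z i + t * of_real (a i))) has_field_derivative G' z) (at 0)"
    using add.IH by blast
  then show ?case
    by (intro exI[of _ "\<lambda>x. f' x + g' x"] exI[of _ "\<lambda>x. F' x + G' x"] conjI)
      (auto intro!: form_fun.add derivative_intros)
next
  case (mult k f F l g G)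
  then obtain f' F' g' G' where
    *: "form_fun (k - 1) f' F'" "k = 0 \<longrightarrow> f' = (\<lambda>x. 0) \<and> F' = (\<lambda>z. 0)"
    "\<forall>x. ((\<lambda>t. f (\<lambda>i. x i + t * a i)) has_field_derivative f' x) (at 0)"
    "\<forall>z. ((\<lambda>t. F (\<lambda>i. z i + t * of_real (a i))) has_field_derivative F' z) (at 0)"
    "form_fun (l - 1) g' G'" "l = 0 \<longrightarrow> g' = (\<lambda>x. 0) \<and> G' = (\<lambda>z. 0)"
    "\<forall>x. ((\<lambda>t. g (\<lambda>i. x i + t * a i)) has_field_derivative g' x) (at 0)"
    "\<forall>z. ((\<lambda>t. G (\<lambda>i. z i + t * of_real (a i))) has_field_derivative G' z) (at 0)"
    using mult.IH by blast
  have left: "form_fun (k + l - 1) (\<lambda>x. f' x * g x) (\<lambda>z. F' z * G z)"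
    by (cases k) (use * form_fun.mult[OF *(1) mult.hyps(2)] in \<open>auto intro: form_fun.zero\<close>)
  have right: "form_fun (k + l - 1) (\<lambda>x. f x * g' x) (\<lambda>z. F z * G' z)"
    by (cases l) (use * form_fun.mult[OF mult.hyps(1) *(5)] in \<open>auto intro: form_fun.zero\<close>)
  show ?case
  proof (intro exI conjI)
    show "form_fun (k + l - 1) (\<lambda>x. f' x * g x + f x * g' x) (\<lambda>z. F' z * G z + F z * G' z)"
      by (rule form_fun.add[OF left right])
    show "\<forall>x. ((\<lambda>t. f (\<lambda>i. x i + t * a i) * g (\<lambda>i. x i + t * a i)) has_field_derivative f' x * g x + f x * g' x) (at 0)"
      using * by (auto intro!: derivative_eq_intros)
    show "\<forall>z. ((\<lambda>t. F (\<lambda>i. z i + t * of_real (a i)) * G (\<lambda>i. z i + t * of_real (a i))) has_field_derivative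
      F' z * G z + F z * G' z) (at 0)"
      using * by (auto intro!: derivative_eq_intros)
    show "k + l = 0 \<longrightarrow> (\<lambda>x. f' x * g x + f x * g' x) = (\<lambda>x. 0) \<and> (\<lambda>z. F' z * G z + F z * G' z) = (\<lambda>z. 0)"
      using * by auto
  qed
qed

lemma
  assumes "form_fun k f F"
  shows form_fun_dir_deriv: "form_fun (k - 1) (dir_deriv a f) (cdir_deriv a F)"
    and form_fun_0_dir_deriv: "k = 0 \<Longrightarrow> dir_deriv a f = (\<lambda>x. 0)"
    and form_fun_has_dir_deriv:
      "((\<lambda>t. f (\<lambda>i. x i + t * a i)) has_field_derivative dir_deriv a f x) (at 0)"
    and form_fun_has_cdir_deriv:
      "((\<lambda>t. F (\<lambda>i. z i + t * of_real (a i))) has_field_derivative cdir_deriv a F z) (at 0)"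
proof -
  obtain f' F' where *: "form_fun (k - 1) f' F'" "k = 0 \<longrightarrow> f' = (\<lambda>x. 0) \<and> F' = (\<lambda>z. 0)"
    "\<And>x. ((\<lambda>t. f (\<lambda>i. x i + t * a i)) has_field_derivative f' x) (at 0)"
    "\<And>z. ((\<lambda>t. F (\<lambda>i. z i + t * of_real (a i))) has_field_derivative F' z) (at 0)"
    using form_fun_dir_deriv_aux[OF assms, of a] by blast
  have eq: "dir_deriv a f = f'" "cdir_deriv a F = F'"
    using *(3,4) by (auto simp: dir_deriv_def cdir_deriv_def fun_eq_iff dest: DERIV_imp_deriv)
  show "form_fun (k - 1) (dir_deriv a f) (cdir_deriv a F)" "k = 0 \<Longrightarrow> dir_deriv a f = (\<lambda>x. 0)"
    "((\<lambda>t. f (\<lambda>i. x i + t * a i)) has_field_derivative dir_deriv a f x) (at 0)"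
    "((\<lambda>t. F (\<lambda>i. z i + t * of_real (a i))) has_field_derivative cdir_deriv a F z) (at 0)"
    using * eq by auto
qed

definition linear_form :: "((nat \<Rightarrow> real) \<Rightarrow> real) \<Rightarrow> bool" where
  "linear_form l \<longleftrightarrow> (\<forall>x y t. l (\<lambda>i. x i + t * y i) = l x + t * l y)"

definition bilinear_form :: "((nat \<Rightarrow> real) \<Rightarrow> (nat \<Rightarrow> real) \<Rightarrow> real) \<Rightarrow> bool" where
  "bilinear_form b \<longleftrightarrow> (\<forall>x. linear_form (b x)) \<and> (\<forall>y. linear_form (\<lambda>x. b x y))"

definition quadratic_form :: "((nat \<Rightarrow> real) \<Rightarrow> real) \<Rightarrow> bool" where
  "quadratic_form f \<longleftrightarrow> (\<exists>b. bilinear_form b \<and> (\<forall>x. f x = b x x))"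

lemma linear_formD: "linear_form l \<Longrightarrow> l (\<lambda>i. x i + t * y i) = l x + t * l y"
  by (simp add: linear_form_def)

lemma linear_form_zero: "linear_form l \<Longrightarrow> l (\<lambda>i. 0) = 0"
  using linear_formD[of l "\<lambda>i. 0" 1 "\<lambda>i. 0"] by simp

lemma linear_form_scale: "linear_form l \<Longrightarrow> l (\<lambda>i. t * y i) = t * l y"
  using linear_formD[of l "\<lambda>i. 0" t y] by (simp add: linear_form_zero)

lemma form_fun_low_degree:
  assumes "form_fun k f F"
  shows "(k = 0 \<longrightarrow> (\<exists>c. f = (\<lambda>x. c))) \<and> (k = 1 \<longrightarrow> linear_form f) \<and> (k = 2 \<longrightarrow> quadratic_form f)"
  using assms
proof induction
  case (zero k)
  show ?case
    by (auto simp: linear_form_def quadratic_form_def bilinear_form_def intro!: exI[of _ "\<lambda>x y. 0"])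
next
  case (const c)
  show ?case by auto
next
  case (coord i)
  show ?case by (auto simp: linear_form_def)
next
  case (add k f F g G)
  have "quadratic_form (\<lambda>x. f x + g x)" if fg: "quadratic_form f" "quadratic_form g"
  proof -
    obtain b c where "bilinear_form b" "\<forall>x. f x = b x x" "bilinear_form c" "\<forall>x. g x = c x x"
      using fg unfolding quadratic_form_def by blast
    then show ?thesis
      unfolding quadratic_form_def
      by (intro exI[of _ "\<lambda>x y. b x y + c x y"]) (simp add: bilinear_form_def linear_form_def algebra_simps)
  qed
  moreover have "linear_form (\<lambda>x. f x + g x)" if "linear_form f" "linear_form g"
    using that by (simp add: linear_form_def algebra_simps)
  moreover have "\<exists>c. (\<lambda>x. f x + g x) = (\<lambda>x. c)" if "\<exists>c. f = (\<lambda>x. c)" "\<exists>c. g = (\<lambda>x. c)"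
    using that by fastforce
  ultimately show ?case using add.IH by blast
next
  case (mult k f F l g G)
  consider "k + l > 2" | "k = 0" | "l = 0" | "k = 1" "l = 1"
    by linarith
  then show ?case
  proof cases
    case 1
    then show ?thesis by auto
  next
    case 2
    then obtain c where f: "f = (\<lambda>x. c)" using mult.IH by blast
    have "quadratic_form (\<lambda>x. c * g x)" if g: "quadratic_form g"
    proof -
      obtain b where "bilinear_form b" "\<forall>x. g x = b x x"
        using g unfolding quadratic_form_def by blast
      then show ?thesis unfolding quadratic_form_def
        by (intro exI[of _ "\<lambda>x y. c * b x y"]) (simp add: bilinear_form_def linear_form_def algebra_simps)
    qed
    moreover have "linear_form (\<lambda>x. c * g x)" if "linear_form g"
      using that by (simp add: linear_form_def algebra_simps)
    moreover have "\<exists>d. (\<lambda>x. c * g x) = (\<lambda>x. d)" if "\<exists>c. g = (\<lambda>x. c)"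
      using that by fastforce
    ultimately show ?thesis using mult.IH(2) 2 unfolding f by simp
  next
    case 3
    then obtain c where g: "g = (\<lambda>x. c)" using mult.IH by blast
    have "quadratic_form (\<lambda>x. f x * c)" if f: "quadratic_form f"
    proof -
      obtain b where "bilinear_form b" "\<forall>x. f x = b x x"
        using f unfolding quadratic_form_def by blast
      then show ?thesis unfolding quadratic_form_def
        by (intro exI[of _ "\<lambda>x y. b x y * c"]) (simp add: bilinear_form_def linear_form_def algebra_simps)
    qed
    moreover have "linear_form (\<lambda>x. f x * c)" if "linear_form f"
      using that by (simp add: linear_form_def algebra_simps)
    moreover have "\<exists>d. (\<lambda>x. f x * c) = (\<lambda>x. d)" if "\<exists>c. f = (\<lambda>x. c)"
      using that by fastforce
    ultimately show ?thesis using mult.IH(1) 3 unfolding g by simp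
  next
    case 4
    then have "linear_form f" "linear_form g" using mult.IH by auto
    then have "quadratic_form (\<lambda>x. f x * g x)"
      unfolding quadratic_form_def
      by (intro exI[of _ "\<lambda>x y. f x * g y"]) (simp add: bilinear_form_def linear_form_def algebra_simps)
    then show ?thesis using 4 by simp
  qed
qed

lemma quadratic_form_line:
  assumes "quadratic_form f"
  obtains b where "bilinear_form b" "\<And>x y s. f (\<lambda>i. x i + s * y i) = f x + s * b x y + s\<^sup>2 * f y"
proof -
  obtain c where c: "bilinear_form c" "\<forall>x. f x = c x x"
    using assms unfolding quadratic_form_def by blast
  show ?thesis
  proof (rule that[of "\<lambda>x y. c x y + c y x"])
    show "bilinear_form (\<lambda>x y. c x y + c y x)"
      using c(1) by (simp add: bilinear_form_def linear_form_def algebra_simps)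
  next
    fix x y s
    have "c (\<lambda>i. x i + s * y i) (\<lambda>i. x i + s * y i)
      = c x x + s * c x y + s * (c y x + s * c y y)"
      using c(1) by (simp add: bilinear_form_def linear_form_def algebra_simps)
    then show "f (\<lambda>i. x i + s * y i) = f x + s * (c x y + c y x) + s\<^sup>2 * f y"
      using c(2) by (simp add: power2_eq_square algebra_simps)
  qed
qed

lemma form_fun_diff:
  assumes "form_fun k f F" "form_fun k g G"
  shows "form_fun k (\<lambda>x. f x - g x) (\<lambda>z. F z - G z)"
proof -
  have "form_fun k (\<lambda>x. - 1 * g x) (\<lambda>z. of_real (- 1) * G z)"
    using form_fun.mult[OF form_fun.const[of "- 1"] assms(2)] by (simp only: add_0)
  from form_fun.add[OF assms(1) this] show ?thesis by simp
qed

text \<open>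
  If \<open>d = 1\<close> the product with the second derivative is not visibly of degree \<open>2 * (d - 1)\<close>, but it is zero.
\<close>
lemma form_fun_Wronskian:
  assumes F: "form_fun d f F" and "d > 0"
  obtains G where
    "form_fun (2 * (d - 1)) (\<lambda>x. dir_deriv u f x * dir_deriv v f x - f x * dir_deriv u (dir_deriv v f) x) G"
proof -
  note Du = form_fun_dir_deriv[OF F, of u]
  note Dv = form_fun_dir_deriv[OF F, of v]
  note Duv = form_fun_dir_deriv[OF Dv, of u]
  have "form_fun (2 * (d - 1)) (\<lambda>x. f x * dir_deriv u (dir_deriv v f) x)
    (\<lambda>z. if d = 1 then 0 else F z * cdir_deriv u (cdir_deriv v F) z)"
  proof (cases "d = 1")
    case True
    then show ?thesis using form_fun_0_dir_deriv[OF Dv, of u] by (simp add: form_fun.zero)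
  next
    case False
    then have "d + (d - 1 - 1) = 2 * (d - 1)" using \<open>d > 0\<close> by simp
    then show ?thesis using form_fun.mult[OF F Duv] False by simp
  qed
  moreover have "d - 1 + (d - 1) = 2 * (d - 1)" by simp
  ultimately show ?thesis
    using form_fun_diff form_fun.mult[OF Du Dv] that by metis
qed

section \<open>Stability of hyperbolic polynomials\<close>

lemma complex_poly_root_multiset:
  fixes q :: "complex poly"
  assumes "q \<noteq> 0"
  obtains A where "size A = degree q" "q = smult (lead_coeff q) (\<Prod>x\<in>#A. [:-x, 1:])"
    "\<And>x. x \<in># A \<Longrightarrow> poly q x = 0"
proof -
  obtain A where A: "size A = degree q" "q = smult (lead_coeff q) (\<Prod>x\<in>#A. [:-x, 1:])"
    using alg_closed_imp_factorization[OF assms] by blast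
  have "poly q x = 0" if "x \<in># A" for x
  proof -
    have "poly (\<Prod>x\<in>#A. [:-x, 1:]) x = 0"
      using that by (induction A) auto
    then show ?thesis by (metis A(2) poly_smult mult_zero_right)
  qed
  with A that show ?thesis by blast
qed

text \<open>
  A root \<open>x\<close> on or below the real axis has distance at least \<open>Im s\<close> from a point \<open>s\<close> of the upper half plane. Unlike
  the absence of zeros in the upper half plane, the resulting inequality is preserved by limits.
\<close>
lemma poly_ge_of_roots_below:
  fixes q :: "complex poly"
  assumes roots: "\<And>s. poly q s = 0 \<Longrightarrow> Im s \<le> 0"
    and "degree q \<le> d" "coeff q d \<noteq> 0" "Im s \<ge> 0"
  shows "cmod (coeff q d) * Im s ^ d \<le> cmod (poly q s)"
proof -
  have d: "degree q = d" using assms le_degree by (metis le_antisym)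
  have "q \<noteq> 0" using assms(3) by auto
  then obtain A where A: "size A = degree q" "q = smult (lead_coeff q) (\<Prod>x\<in>#A. [:-x, 1:])"
    "\<And>x. x \<in># A \<Longrightarrow> poly q x = 0"
    using complex_poly_root_multiset by blast
  have "(\<And>x. x \<in># A \<Longrightarrow> Im x \<le> 0) \<Longrightarrow> Im s ^ size A \<le> cmod (poly (\<Prod>x\<in>#A. [:-x, 1:]) s)"
  proof (induction A)
    case empty
    then show ?case by simp
  next
    case (add x A)
    have "Im s \<le> cmod (s - x)"
      using abs_Im_le_cmod[of "s - x"] add.prems[of x] by auto
    moreover have "poly (\<Prod>x\<in>#add_mset x A. [:-x, 1:]) s = (s - x) * poly (\<Prod>x\<in>#A. [:-x, 1:]) s"
      by (simp add: algebra_simps)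
    ultimately show ?case
      using add \<open>Im s \<ge> 0\<close> by (auto simp: norm_mult intro!: mult_mono)
  qed
  then have "Im s ^ d \<le> cmod (poly (\<Prod>x\<in>#A. [:-x, 1:]) s)"
    using A(1,3) roots d by auto
  then have "cmod (lead_coeff q) * Im s ^ d \<le> cmod (poly (smult (lead_coeff q) (\<Prod>x\<in>#A. [:-x, 1:])) s)"
    by (simp add: norm_mult mult_left_mono)
  then show ?thesis by (simp only: A(2)[symmetric] d[symmetric])
qed

text \<open>
  The sign of the imaginary part of the logarithmic derivative, with denominators cleared. It is additive over
  products up to positive factors, so the factors \<open>t - x\<close> decide.
\<close>
lemma log_deriv_lower_half_plane:
  fixes q :: "complex poly"
  assumes roots: "\<And>s. poly q s = 0 \<Longrightarrow> Im s \<le> 0"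
  shows "Im (poly (pderiv q) 0 * cnj (poly q 0)) \<le> 0"
proof (cases "q = 0")
  case True
  then show ?thesis by simp
next
  case False
  then obtain A where A: "q = smult (lead_coeff q) (\<Prod>x\<in>#A. [:-x, 1:])"
    "\<And>x. x \<in># A \<Longrightarrow> poly q x = 0"
    using complex_poly_root_multiset by blast
  then have roots': "Im x \<le> 0" if "x \<in># A" for x
    using roots that by blast
  define r where "r = (\<Prod>x\<in>#A. [:-x, 1:])"
  have "Im (poly (pderiv r) 0 * cnj (poly r 0)) \<le> 0"
    using roots' unfolding r_def
  proof (induction A)
    case empty
    then show ?case by simp
  next
    case (add x A)
    define r where "r = (\<Prod>x\<in>#A. [:-x, 1:])"
    have IH: "Im (poly (pderiv r) 0 * cnj (poly r 0)) \<le> 0"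
      using add unfolding r_def by simp
    have "poly (pderiv ([:-x, 1:] * r)) 0 * cnj (poly ([:-x, 1:] * r) 0)
      = of_real ((cmod x)\<^sup>2) * (poly (pderiv r) 0 * cnj (poly r 0))
        - of_real ((cmod (poly r 0))\<^sup>2) * cnj x"
      unfolding complex_norm_square pderiv_mult by (simp add: pderiv_pCons) (simp add: algebra_simps)
    then have "Im (poly (pderiv ([:-x, 1:] * r)) 0 * cnj (poly ([:-x, 1:] * r) 0))
      = (cmod x)\<^sup>2 * Im (poly (pderiv r) 0 * cnj (poly r 0)) + (cmod (poly r 0))\<^sup>2 * Im x"
      by simp
    also have "\<dots> \<le> 0"
      using IH add.prems[of x] by (intro add_nonpos_nonpos mult_nonneg_nonpos) auto
    finally show ?case by (simp add: r_def)
  qed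
  moreover have "Im (poly (pderiv q) 0 * cnj (poly q 0))
    = (cmod (lead_coeff q))\<^sup>2 * Im (poly (pderiv r) 0 * cnj (poly r 0))"
  proof -
    define c where "c = lead_coeff q"
    have q: "q = smult c r" unfolding c_def r_def by (rule A(1))
    have "poly (pderiv q) 0 * cnj (poly q 0) = of_real ((cmod c)\<^sup>2) * (poly (pderiv r) 0 * cnj (poly r 0))"
      unfolding complex_norm_square q by (simp add: pderiv_smult)
    moreover have "Im (of_real a * z) = a * Im z" for a z
      by simp
    ultimately show ?thesis unfolding c_def by (simp only:)
  qed
  ultimately show ?thesis
    by (metis mult_nonneg_nonpos zero_le_power2)
qed

text \<open>
  The deformation argument behind Garding's theorem. As \<open>\<alpha>\<close> moves from \<open>0\<close> to \<open>1\<close>, the zeros of \<open>s \<mapsto> F (\<alpha> y + z + s b)\<close>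
  start below the real axis, never lie on it, and keep their number because the leading coefficient \<open>F b\<close>
  is fixed; hence they end below it. The parameters \<open>\<alpha>\<close> for which all zeros lie below form
  a closed set by the lower bound \<open>poly_ge_of_roots_below\<close>. The remaining ones also do: with homogeneous
  coordinates \<open>(r, s)\<close> on a compact half sphere in place of \<open>s / r\<close>, they are the projection of a compact set \<open>K\<close>.
  By connectedness one of the two sets is empty.
\<close>
lemma roots_stay_below:
  fixes y b :: "nat \<Rightarrow> complex"
  assumes F: "form_fun d f F" and lead: "F b \<noteq> 0"
    and real: "\<And>\<alpha> t::real. \<alpha> \<in> {0..1} \<Longrightarrow> F (\<lambda>i. (of_real \<alpha> * y i + z i) + of_real t * b i) \<noteq> 0"
    and start: "\<And>s. Im s \<ge> 0 \<Longrightarrow> F (\<lambda>i. z i + s * b i) \<noteq> 0"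
    and s: "Im s \<ge> 0"
  shows "F (\<lambda>i. (y i + z i) + s * b i) \<noteq> 0"
proof -
  define G where "G = (\<lambda>(\<alpha>::real) s. F (\<lambda>i. (of_real \<alpha> * y i + z i) + s * b i))"
  define A where "A = {\<alpha> \<in> {0..1}. \<forall>s\<in>{s. Im s \<ge> 0}. cmod (F b) * Im s ^ d \<le> cmod (G \<alpha> s)}"
  \<comment> \<open>\<open>K\<close> encodes the zeros \<open>s / r\<close> in the closed upper half plane; \<open>r = 0\<close> is the point at infinity.\<close>
  define K where "K = {(\<alpha>::real, r::real, s::complex) | \<alpha> r s. \<alpha> \<in> {0..1} \<and> r \<in> {0..1} \<and> s \<in> cball 0 1 \<and>
    r\<^sup>2 + (cmod s)\<^sup>2 = 1 \<and> Im s \<ge> 0 \<and> F (\<lambda>i. of_real r * (of_real \<alpha> * y i + z i) + s * b i) = 0}"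
  have scale: "F (\<lambda>i. of_real r * (of_real \<alpha> * y i + z i) + s * b i) = of_real r ^ d * G \<alpha> (s / of_real r)"
    if "r \<noteq> 0" for r \<alpha> s
    unfolding G_def form_fun_homogeneous(2)[OF F, symmetric]
    by (rule arg_cong[of _ _ F]) (use that in \<open>simp add: fun_eq_iff field_simps\<close>)
  have "closed A"
  proof -
    have "A = {0..1} \<inter> (\<Inter>s\<in>{s. Im s \<ge> 0}. {\<alpha>. cmod (F b) * Im s ^ d \<le> cmod (G \<alpha> s)})"
      by (auto simp: A_def)
    moreover have "closed {\<alpha>. cmod (F b) * Im s ^ d \<le> cmod (G \<alpha> s)}" for s
      unfolding G_def
      by (intro closed_Collect_le continuous_intros form_fun_continuous[OF F])
    ultimately show ?thesis by (auto intro!: closed_Int closed_INT)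
  qed
  moreover have "closed (fst ` K)"
  proof -
    have "K = ({0..1} \<times> {0..1} \<times> cball 0 1) \<inter> {k. (fst (snd k))\<^sup>2 + (cmod (snd (snd k)))\<^sup>2 = 1}
      \<inter> {k. 0 \<le> Im (snd (snd k))}
      \<inter> {k. F (\<lambda>i. of_real (fst (snd k)) * (of_real (fst k) * y i + z i) + snd (snd k) * b i) = 0}"
      by (auto simp: K_def)
    moreover have "compact \<dots>"
      by (intro compact_Int_closed compact_Times compact_Icc compact_cball closed_Collect_eq
          closed_Collect_le continuous_intros form_fun_continuous[OF F])
    ultimately have "compact K" by simp
    then show ?thesis
      by (intro compact_imp_closed compact_continuous_image continuous_intros)
  qed
  moreover have cover: "{0..1} \<subseteq> A \<union> fst ` K"
  proof
    fix \<alpha> :: real assume \<alpha>: "\<alpha> \<in> {0..1}"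
    show "\<alpha> \<in> A \<union> fst ` K"
    proof (cases "\<exists>s. Im s \<ge> 0 \<and> G \<alpha> s = 0")
      case True
      then obtain s where s: "Im s \<ge> 0" "G \<alpha> s = 0" by blast
      \<comment> \<open>The factor that normalizes \<open>(1, s)\<close> to the unit sphere.\<close>
      define r where "r = 1 / sqrt (1 + (cmod s)\<^sup>2)"
      have sq: "sqrt (1 + (cmod s)\<^sup>2) \<ge> 1" by simp
      have r: "0 < r" "r \<le> 1" using sq by (auto simp: r_def add_pos_nonneg)
      have r2: "r\<^sup>2 * (1 + (cmod s)\<^sup>2) = 1"
        by (simp add: r_def power_divide add_nonneg_eq_0_iff)
      have one: "r\<^sup>2 + (cmod (of_real r * s))\<^sup>2 = 1"
        using r2 r by (simp add: norm_mult power_mult_distrib algebra_simps)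
      then have "(cmod (of_real r * s))\<^sup>2 \<le> 1\<^sup>2"
        by (metis add.commute le_add_same_cancel1 one_power2 zero_le_power2)
      then have "cmod (of_real r * s) \<le> 1"
        by (rule power2_le_imp_le) simp
      then have "(\<alpha>, r, of_real r * s) \<in> K"
        using \<alpha> r s one scale[of r \<alpha> "of_real r * s"] by (auto simp: K_def)
      then have "fst (\<alpha>, r, of_real r * s) \<in> fst ` K" by (rule imageI)
      then show ?thesis by simp
    next
      case False
      obtain q where q: "\<And>t. F (\<lambda>i. (of_real \<alpha> * y i + z i) + t * b i) = poly q t" "degree q \<le> d" "coeff q d = F b"
        using form_fun_complex_line[OF F] by metis
      have "Im s \<le> 0" if "poly q s = 0" for s
        using that False q(1) unfolding G_def by (metis linear)
      then have "\<alpha> \<in> A"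
        using poly_ge_of_roots_below[of q d] q \<alpha> lead unfolding A_def G_def by auto
      then show ?thesis ..
    qed
  qed
  moreover have "A \<inter> fst ` K \<inter> {0..1} = {}"
  proof -
    have False if "\<alpha> \<in> A" "(\<alpha>, r, s) \<in> K" for \<alpha> r s
    proof (cases "r = 0")
      case True
      then have "s ^ d * F b = 0" "s \<noteq> 0"
        using that(2) form_fun_homogeneous(2)[OF F, of s b] by (auto simp: K_def)
      then show False using lead by simp
    next
      case False
      have s: "Im (s / of_real r) \<ge> 0" "G \<alpha> (s / of_real r) = 0" "\<alpha> \<in> {0..1}"
        using that(2) False scale[of r \<alpha> s] by (auto simp: K_def Im_divide_of_real)
      show False
      proof (cases "Im (s / of_real r) = 0")
        case True
        then have "s / of_real r = of_real (Re (s / of_real r))"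
          by (simp add: complex_eq_iff)
        then show False
          using real[OF s(3), of "Re (s / of_real r)"] s(2) unfolding G_def by metis
      next
        case False
        then have "cmod (F b) * Im (s / of_real r) ^ d > 0"
          using s(1) lead by (intro mult_pos_pos zero_less_power) (auto simp only: zero_less_norm_iff order_le_less)
        moreover have "cmod (F b) * Im (s / of_real r) ^ d \<le> cmod (G \<alpha> (s / of_real r))"
          using that(1) s(1) unfolding A_def by blast
        ultimately show False
          unfolding s(2) norm_zero by linarith
      qed
    qed
    then show ?thesis by (auto simp only: fst_conv empty_iff)
  qed
  moreover have "A \<inter> {0..1} \<noteq> {}"
  proof -
    obtain q where q: "\<And>t. F (\<lambda>i. z i + t * b i) = poly q t" "degree q \<le> d" "coeff q d = F b"
      using form_fun_complex_line[OF F] by metis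
    have "Im s \<le> 0" if "poly q s = 0" for s
      using that start q(1) by (metis linear)
    then have "0 \<in> A"
      using poly_ge_of_roots_below[of q d] q lead unfolding A_def G_def by auto
    then show ?thesis by auto
  qed
  ultimately have "fst ` K \<inter> {0..1} = {}"
    using connected_closedD[OF connected_Icc[of 0 "1::real"], of A "fst ` K"] by meson
  then have "1 \<in> A"
    using cover by (metis IntI Un_iff atLeastAtMost_iff empty_iff order_refl subsetD zero_le_one)
  then have "cmod (F b) * Im s ^ d \<le> cmod (G 1 s)"
    using s by (simp add: A_def)
  then have "G 1 s \<noteq> 0" if "Im s > 0"
    using that lead by (metis mult_pos_pos norm_zero not_le zero_less_norm_iff zero_less_power)
  moreover have "G 1 s \<noteq> 0" if "Im s = 0"
  proof -
    have "s = of_real (Re s)" using that by (simp add: complex_eq_iff)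
    then show ?thesis using real[of 1 "Re s"] unfolding G_def by (metis atLeastAtMost_iff order_refl zero_le_one)
  qed
  ultimately have "G 1 s \<noteq> 0" using s by linarith
  then show ?thesis by (simp add: G_def)
qed

text \<open>
  Enlarging the set of admissible directions by a vector \<open>v\<close> of the cone. The vector \<open>y\<close> may already be complex, so that
  the lemma can be used twice, for two cone directions in succession. As \<open>F v\<close> may vanish,
  the deformation is carried out for \<open>v + \<delta> e\<close>, and the surplus \<open>t \<delta> e\<close> is absorbed at the end: its real part by
  shifting \<open>y\<close> along \<open>e\<close>, its imaginary part by a small \<open>\<delta>\<close> in \<open>\<beta>\<close>.
\<close>
lemma cone_direction_stable:
  fixes y :: "nat \<Rightarrow> complex" and e v :: "nat \<Rightarrow> real"
  assumes F: "form_fun d f F" and e: "F (\<lambda>i. of_real (e i)) \<noteq> 0"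
    and v: "\<And>\<tau>. F (\<lambda>i. \<tau> * of_real (e i) - of_real (v i)) = 0 \<Longrightarrow> \<tau> \<in> \<real>\<^sub>\<ge>\<^sub>0"
    and real: "\<And>\<alpha> \<beta> t r::real. \<alpha> \<in> {0..1} \<Longrightarrow> \<beta> > 0 \<Longrightarrow>
      F (\<lambda>i. of_real \<alpha> * y i + of_real (t * v i + r * e i) + \<i> * of_real (\<beta> * e i)) \<noteq> 0"
    and "\<beta> > 0" "Im t \<ge> 0"
  shows "F (\<lambda>i. y i + t * of_real (v i) + \<i> * of_real (\<beta> * e i)) \<noteq> 0"
proof -
  have real': "F (\<lambda>i. of_real \<alpha> * (y i - of_real (r0 * e i)) + of_real (t * v i + r * e i) + \<i> * of_real (\<beta> * e i)) \<noteq> 0"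
    if "\<alpha> \<in> {0..1}" "\<beta> > 0" for \<alpha> \<beta> t r r0
    using real[OF that, of t "r - \<alpha> * r0"] by (simp add: algebra_simps)
  have inner: "F (\<lambda>i. ((y i - of_real (r0 * e i)) + \<i> * of_real (\<beta> * e i)) + s * of_real (v i + \<delta> * e i)) \<noteq> 0"
    if \<delta>: "\<delta> > 0" and \<beta>: "\<beta> > 0" and "Im s \<ge> 0" for \<delta> \<beta> r0 :: real and s
  proof (rule roots_stay_below[OF F _ _ _ \<open>Im s \<ge> 0\<close>])
    show "F (\<lambda>i. of_real (v i + \<delta> * e i)) \<noteq> 0"
    proof
      assume "F (\<lambda>i. of_real (v i + \<delta> * e i)) = 0"
      then have "F (\<lambda>i. (-1) * of_real (v i + \<delta> * e i)) = 0"
        unfolding form_fun_homogeneous(2)[OF F] by simp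
      moreover have "(\<lambda>i. (-1) * of_real (v i + \<delta> * e i))
        = (\<lambda>i. of_real (- \<delta>) * of_real (e i) - complex_of_real (v i))"
        by (rule ext) (simp add: algebra_simps)
      ultimately have "F (\<lambda>i. of_real (- \<delta>) * of_real (e i) - of_real (v i)) = 0"
        by simp
      then show False using v[of "of_real (- \<delta>)"] \<delta> by (simp del: of_real_minus)
    qed
  next
    fix \<alpha> t :: real assume "\<alpha> \<in> {0..1}"
    then show "F (\<lambda>i. (of_real \<alpha> * (y i - of_real (r0 * e i)) + \<i> * of_real (\<beta> * e i)) + of_real t * of_real (v i + \<delta> * e i)) \<noteq> 0"
      using real'[of \<alpha> \<beta> r0 t "t * \<delta>"] \<beta> by (simp add: algebra_simps)
  next
    fix s assume s: "Im s \<ge> 0"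
    show "F (\<lambda>i. \<i> * of_real (\<beta> * e i) + s * of_real (v i + \<delta> * e i)) \<noteq> 0"
    proof
      assume zero: "F (\<lambda>i. \<i> * of_real (\<beta> * e i) + s * of_real (v i + \<delta> * e i)) = 0"
      have "s \<noteq> 0"
      proof
        assume "s = 0"
        then have "F (\<lambda>i. (\<i> * of_real \<beta>) * of_real (e i)) = 0"
          using zero by (simp add: algebra_simps)
        then show False
          unfolding form_fun_homogeneous(2)[OF F] using e \<beta> by simp
      qed
      define \<tau> where "\<tau> = - (\<i> * of_real \<beta> / s + of_real \<delta>)"
      have "F (\<lambda>i. (- s) * (\<tau> * of_real (e i) - of_real (v i))) = 0"
        using zero \<open>s \<noteq> 0\<close> by (simp add: \<tau>_def algebra_simps)
      then have "\<tau> \<in> \<real>\<^sub>\<ge>\<^sub>0"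
        unfolding form_fun_homogeneous(2)[OF F] using v[of \<tau>] \<open>s \<noteq> 0\<close> by simp
      then obtain \<rho> where \<rho>: "\<tau> = of_real \<rho>" "\<rho> \<ge> 0"
        by (auto simp: nonneg_Reals_def)
      have "- (\<i> * of_real \<beta>) = of_real (\<rho> + \<delta>) * s"
        using \<rho>(1) \<open>s \<noteq> 0\<close> by (simp add: \<tau>_def field_simps)
      then have "Im (- (\<i> * of_real \<beta>)) = Im (of_real (\<rho> + \<delta>) * s)" by (rule arg_cong)
      then have "- \<beta> = (\<rho> + \<delta>) * Im s" by simp
      moreover have "(\<rho> + \<delta>) * Im s \<ge> 0" using \<rho> \<delta> s by simp
      ultimately show False using \<beta> by simp
    qed
  qed
  \<comment> \<open>Small enough for \<open>\<delta> * Im t\<close> to stay below \<open>\<beta>\<close>.\<close>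
  define \<delta> where "\<delta> = \<beta> / (2 * (1 + Im t))"
  have \<delta>: "\<delta> > 0" using assms by (simp add: \<delta>_def)
  have "\<delta> * Im t \<le> \<beta> / 2" using assms by (simp add: \<delta>_def field_simps)
  then have \<beta>': "\<beta> - \<delta> * Im t > 0" using \<open>\<beta> > 0\<close> by simp
  have "F (\<lambda>i. (y i - of_real (\<delta> * Re t * e i) + \<i> * of_real ((\<beta> - \<delta> * Im t) * e i)) + t * of_real (v i + \<delta> * e i)) \<noteq> 0"
    using inner[OF \<delta> \<beta>' \<open>Im t \<ge> 0\<close>] .
  moreover have "(\<lambda>i. (y i - of_real (\<delta> * Re t * e i) + \<i> * of_real ((\<beta> - \<delta> * Im t) * e i)) + t * of_real (v i + \<delta> * e i))
    = (\<lambda>i. y i + t * of_real (v i) + \<i> * of_real (\<beta> * e i))"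
    by (rule ext) (simp add: complex_eq_iff algebra_simps)
  ultimately show ?thesis by simp
qed


text \<open>
  The imaginary part of the argument is \<open>Im s\<close> times \<open>u\<close> plus \<open>Im t\<close> times \<open>v\<close> plus \<open>\<beta>\<close> times \<open>e\<close>, an interior vector of the
  hyperbolicity cone. Hyperbolicity is the case \<open>s = t = 0\<close>; the two cone directions are then added one after the other.
\<close>
lemma hyperbolic_stable:
  assumes p: "p \<in> hyperbolic n d e" and e: "e \<in> vecs n"
    and u: "u \<in> hyp_cone n p e" and v: "v \<in> hyp_cone n p e" and x: "x \<in> vecs n"
    and "\<beta> > 0" "Im s \<ge> 0" "Im t \<ge> 0"
  shows "eval p (\<lambda>i. (of_real (x i) + s * of_real (u i)) + t * of_real (v i) + \<i> * of_real (\<beta> * e i)) \<noteq> 0"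
proof -
  have F: "form_fun d (eval p) (eval p)"
    using p by (auto simp: hyperbolic_def intro: form_fun_eval)
  have "eval p (\<lambda>i. complex_of_real (e i)) = of_real (eval p e)"
    by (rule form_fun_of_real[OF F])
  then have e0: "eval p (\<lambda>i. complex_of_real (e i)) \<noteq> 0"
    using p by (auto simp: hyperbolic_def)
  have cone: "\<tau> \<in> \<real>\<^sub>\<ge>\<^sub>0" if "w \<in> hyp_cone n p e" "eval p (\<lambda>i. \<tau> * of_real (e i) - of_real (w i)) = 0" for w and \<tau> :: complex
    using that by (auto simp: hyp_cone_def roots_along_def)
  have uv: "u \<in> vecs n" "v \<in> vecs n"
    using u v by (auto simp: hyp_cone_def)
  have hyp: "eval p (\<lambda>i. of_real (a i) + \<i> * of_real (\<beta> * e i)) \<noteq> 0"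
    if "a \<in> vecs n" "\<beta> > 0" for a \<beta>
  proof
    assume "eval p (\<lambda>i. of_real (a i) + \<i> * of_real (\<beta> * e i)) = 0"
    moreover have "(\<lambda>i. of_real (a i) + \<i> * of_real (\<beta> * e i))
      = (\<lambda>i. (\<i> * of_real \<beta>) * of_real (e i) - of_real ((\<lambda>i. - a i) i))"
      by (rule ext) simp
    ultimately have "\<i> * of_real \<beta> \<in> roots_along p e (\<lambda>i. - a i)"
      by (simp add: roots_along_def)
    moreover have "(\<lambda>i. - a i) \<in> vecs n"
      using that by (auto simp: vecs_def)
    ultimately have "\<i> * of_real \<beta> \<in> \<real>"
      using p by (auto simp: hyperbolic_def)
    then show False using \<open>\<beta> > 0\<close> by (simp add: complex_is_Real_iff)
  qed
  have one: "eval p (\<lambda>i. of_real (a i) + s * of_real (u i) + \<i> * of_real (\<beta> * e i)) \<noteq> 0"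
    if a: "a \<in> vecs n" and "\<beta> > 0" "Im s \<ge> 0" for a s \<beta>
  proof (rule cone_direction_stable[OF F e0 cone[OF u] _ that(2,3)])
    fix \<alpha> \<beta> t r :: real assume "\<alpha> \<in> {0..1}" "\<beta> > 0"
    have "(\<lambda>i. \<alpha> * a i + (t * u i + r * e i)) \<in> vecs n"
      using a uv e by (auto simp: vecs_def)
    from hyp[OF this \<open>\<beta> > 0\<close>]
    show "eval p (\<lambda>i. of_real \<alpha> * of_real (a i) + of_real (t * u i + r * e i) + \<i> * of_real (\<beta> * e i)) \<noteq> 0"
      by simp
  qed
  show ?thesis
  proof (rule cone_direction_stable[OF F e0 cone[OF v] _ assms(6,8)])
    fix \<alpha> \<beta> t r :: real assume \<alpha>: "\<alpha> \<in> {0..1}" and "\<beta> > 0"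
    have "(\<lambda>i. \<alpha> * x i + (t * v i + r * e i)) \<in> vecs n"
      using x uv e by (auto simp: vecs_def)
    from one[OF this \<open>\<beta> > 0\<close>, of "of_real \<alpha> * s"]
    show "eval p (\<lambda>i. of_real \<alpha> * (of_real (x i) + s * of_real (u i)) + of_real (t * v i + r * e i) + \<i> * of_real (\<beta> * e i)) \<noteq> 0"
      using \<alpha> assms(7) by (simp add: algebra_simps)
  qed
qed

text \<open>
  Along \<open>\<eta> \<mapsto> x + i\<eta> u\<close> the imaginary part of \<open>D\<^sub>v p\<close> times the conjugate of \<open>p\<close> is never positive for \<open>\<eta> > 0\<close>, by
  stability, and is zero at the real point \<open>x\<close>. Hence its derivative \<open>W\<close> at \<open>\<eta> = 0\<close> is not positive, and \<open>- W\<close> is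
  the claimed expression.
\<close>
lemma Rayleigh_inequality:
  assumes p: "p \<in> hyperbolic n d e" and e: "e \<in> vecs n"
    and u: "u \<in> hyp_cone n p e" and v: "v \<in> hyp_cone n p e" and x: "x \<in> vecs n"
  shows "dir_deriv u (eval p) x * dir_deriv v (eval p) x
    - eval p x * dir_deriv u (dir_deriv v (eval p)) x \<ge> 0"
proof -
  define F :: "(nat \<Rightarrow> complex) \<Rightarrow> complex" where "F = eval p"
  have F: "form_fun d (eval p) F"
    using p unfolding F_def by (auto simp: hyperbolic_def intro: form_fun_eval)
  define z where "z = (\<lambda>\<beta> s i. of_real (x i) + s * of_real (u i) + \<i> * of_real (\<beta> * e i))"
  note D = form_fun_dir_deriv[OF F, of v]
  have pos: "Im (cdir_deriv v F (z \<beta> s) * cnj (F (z \<beta> s))) \<le> 0" if "\<beta> > 0" "Im s \<ge> 0" for \<beta> s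
  proof -
    obtain q where q: "\<And>t. F (\<lambda>i. z \<beta> s i + t * of_real (v i)) = poly q t"
      using form_fun_complex_line[OF F] by metis
    have "((\<lambda>t. poly q t) has_field_derivative cdir_deriv v F (z \<beta> s)) (at 0)"
      using form_fun_has_cdir_deriv[OF F, of "z \<beta> s" v] unfolding q .
    then have "cdir_deriv v F (z \<beta> s) = poly (pderiv q) 0"
      using poly_DERIV DERIV_unique by blast
    moreover have "F (z \<beta> s) = poly q 0"
      using q[of 0] by simp
    moreover have "Im t \<le> 0" if "poly q t = 0" for t
    proof (rule ccontr)
      assume "\<not> Im t \<le> 0"
      then have "F (\<lambda>i. z \<beta> s i + t * of_real (v i)) \<noteq> 0"
        using hyperbolic_stable[OF p e u v x \<open>\<beta> > 0\<close> \<open>Im s \<ge> 0\<close>, of t]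
        unfolding F_def z_def by (simp add: algebra_simps)
      then show False using that q by simp
    qed
    ultimately show ?thesis
      using log_deriv_lower_half_plane[of q] by simp
  qed
  have pos0: "Im (cdir_deriv v F (z 0 s) * cnj (F (z 0 s))) \<le> 0" if "Im s \<ge> 0" for s
  proof -
    define g where "g = (\<lambda>\<beta>. Im (cdir_deriv v F (z \<beta> s) * cnj (F (z \<beta> s))))"
    have "continuous_on UNIV g"
      unfolding g_def z_def
      by (intro continuous_intros form_fun_continuous[OF F] form_fun_continuous[OF D])
    then have "(g \<longlongrightarrow> g 0) (at_right 0)"
      by (simp add: continuous_on_eq_continuous_at isCont_def filterlim_at_split)
    moreover have "eventually (\<lambda>\<beta>. g \<beta> \<le> 0) (at_right 0)"
      using pos[OF _ that] unfolding g_def eventually_at_right_field by (auto intro: exI[of _ 1])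
    ultimately have "g 0 \<le> 0"
      by (rule tendsto_upperbound) simp
    then show ?thesis by (simp add: g_def)
  qed
  define P where "P = (\<lambda>s. F (z 0 s))"
  define R where "R = (\<lambda>s. cdir_deriv v F (z 0 s))"
  have z0: "z 0 s = (\<lambda>i. of_real (x i) + s * of_real (u i))" for s
    by (simp add: z_def)
  have P0: "P 0 = of_real (eval p x)" and R0: "R 0 = of_real (dir_deriv v (eval p) x)"
    using form_fun_of_real[OF F] form_fun_of_real[OF D] by (simp_all add: P_def R_def z0)
  have P': "(P has_field_derivative of_real (dir_deriv u (eval p) x)) (at 0)"
    using form_fun_has_cdir_deriv[OF F, of "\<lambda>i. of_real (x i)" u]
      form_fun_of_real[OF form_fun_dir_deriv[OF F, of u]] by (simp add: P_def z0)
  have R': "(R has_field_derivative of_real (dir_deriv u (dir_deriv v (eval p)) x)) (at 0)"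
    using form_fun_has_cdir_deriv[OF D, of "\<lambda>i. of_real (x i)" u]
      form_fun_of_real[OF form_fun_dir_deriv[OF D, of u]] by (simp add: R_def z0)
  have line: "((\<lambda>\<eta>. of_real \<eta> * \<i>) has_vector_derivative \<i>) (at 0)"
    by (auto intro!: derivative_eq_intros)
  have P'': "((\<lambda>\<eta>. P (of_real \<eta> * \<i>)) has_vector_derivative \<i> * of_real (dir_deriv u (eval p) x)) (at 0)"
    using field_vector_diff_chain_at[OF line, of P] P' by (simp add: o_def)
  have R'': "((\<lambda>\<eta>. R (of_real \<eta> * \<i>)) has_vector_derivative \<i> * of_real (dir_deriv u (dir_deriv v (eval p)) x)) (at 0)"
    using field_vector_diff_chain_at[OF line, of R] R' by (simp add: o_def)
  define \<phi> where "\<phi> = (\<lambda>\<eta>::real. Im (R (of_real \<eta> * \<i>) * cnj (P (of_real \<eta> * \<i>))))"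
  define W where "W = dir_deriv u (dir_deriv v (eval p)) x * eval p x - dir_deriv v (eval p) x * dir_deriv u (eval p) x"
  have "(\<phi> has_vector_derivative Im (R 0 * cnj (\<i> * of_real (dir_deriv u (eval p) x))
      + \<i> * of_real (dir_deriv u (dir_deriv v (eval p)) x) * cnj (P 0))) (at 0)"
    unfolding \<phi>_def
    using has_vector_derivative_mult[OF R'' has_vector_derivative_cnj[OF P'']]
    by (intro bounded_linear.has_vector_derivative[OF bounded_linear_Im]) simp
  then have "(\<phi> has_real_derivative W) (at 0)"
    by (simp add: P0 R0 has_real_derivative_iff_has_vector_derivative W_def)
  moreover have "\<phi> \<eta> \<le> 0" if "\<eta> > 0" for \<eta>
    using pos0[of "of_real \<eta> * \<i>"] that by (simp add: \<phi>_def R_def P_def)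
  moreover have "\<phi> 0 = 0"
    by (simp add: \<phi>_def P0 R0)
  ultimately have "W \<le> 0"
    using DERIV_pos_inc_right[of \<phi> W 0]
    by (metis add_0 dense not_less order_less_irrefl)
  then show ?thesis by (simp add: W_def algebra_simps)
qed

section \<open>Quaternionic matrices and their determinant\<close>

instantiation quat :: (comm_ring_1) ring_1
begin

definition zero_quat :: "'a quat" where "zero_quat = Quat 0 0 0 0"

definition one_quat :: "'a quat" where "one_quat = Quat 1 0 0 0"

fun uminus_quat :: "'a quat \<Rightarrow> 'a quat" where
  "uminus_quat (Quat a b c d) = Quat (- a) (- b) (- c) (- d)"

fun minus_quat :: "'a quat \<Rightarrow> 'a quat \<Rightarrow> 'a quat" where
  "minus_quat (Quat a b c d) (Quat a' b' c' d') = Quat (a - a') (b - b') (c - c') (d - d')"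

instance
proof
  fix a b c :: "'a quat"
  show "a * b * c = a * (b * c)"
    by (cases a; cases b; cases c) (simp add: algebra_simps)
  show "(a + b) * c = a * c + b * c" "a * (b + c) = a * b + a * c"
    by (cases a; cases b; cases c; simp add: algebra_simps)+
  show "a + b + c = a + (b + c)"
    by (cases a; cases b; cases c) (simp add: algebra_simps)
  show "a + b = b + a" "a - b = a + - b"
    by (cases a; cases b; simp add: algebra_simps)+
  show "0 + a = a" "- a + a = 0" "1 * a = a" "a * 1 = a"
    by (cases a; simp add: zero_quat_def one_quat_def)+
  show "(0 :: 'a quat) \<noteq> 1"
    by (simp add: zero_quat_def one_quat_def)
qed

end

definition qscalar :: "'a::comm_ring_1 \<Rightarrow> 'a quat" where
  "qscalar r = Quat r 0 0 0"

lemma qscalar_simps [simp]: "qscalar 0 = 0" "qscalar 1 = 1"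
  by (simp_all add: qscalar_def zero_quat_def one_quat_def)

lemma qscalar_mult: "qscalar (r * s) = qscalar r * qscalar s"
  by (simp add: qscalar_def)

lemma qscalar_commute: "q * qscalar r = qscalar r * q"
  by (cases q) (simp add: qscalar_def algebra_simps)

lemma mult_qconj: "q * qconj q = qscalar (qnorm2 q)" "qconj q * q = qscalar (qnorm2 q)"
  by (simp_all add: quat_mult_qconj qscalar_def)

lemma qconj_zero [simp]: "qconj 0 = 0"
  by (simp add: zero_quat_def)

lemma qconj_add: "qconj (p + q) = qconj p + qconj q"
  by (cases p; cases q) simp

lemma qconj_mult: "qconj (p * q) = qconj q * qconj p" for p q :: "'a::comm_ring_1 quat"
  by (cases p; cases q) (simp add: algebra_simps)

lemma qconj_qconj [simp]: "qconj (qconj q) = q"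
  by (cases q) simp

lemma qnorm2_simps [simp]: "qnorm2 0 = 0" "qnorm2 1 = 1" "qnorm2 (qscalar r) = r\<^sup>2"
  "qnorm2 (qconj q) = qnorm2 q"
  by (cases q; simp add: zero_quat_def one_quat_def qscalar_def)+

lemma qnorm2_mult: "qnorm2 (p * q) = qnorm2 p * qnorm2 q"
  by (cases p; cases q) (simp add: power2_eq_square algebra_simps)

lemma qnorm2_nonneg [simp]: "qnorm2 q \<ge> 0" for q :: "real quat"
  by (cases q) simp

lemma qnorm2_eq_0_iff [simp]: "qnorm2 q = 0 \<longleftrightarrow> q = 0" for q :: "real quat"
  by (cases q) (auto simp: zero_quat_def add_nonneg_eq_0_iff)

lemma qnorm2_pos [simp]: "qnorm2 q > 0 \<longleftrightarrow> q \<noteq> 0" for q :: "real quat"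
  using qnorm2_nonneg[of q] qnorm2_eq_0_iff[of q] by linarith

definition qinv :: "real quat \<Rightarrow> real quat" where
  "qinv q = qscalar (inverse (qnorm2 q)) * qconj q"

lemma qinv:
  assumes "q \<noteq> 0"
  shows "q * qinv q = 1" "qinv q * q = 1"
proof -
  have 1: "qscalar (inverse (qnorm2 q)) * qscalar (qnorm2 q) = 1"
    using assms by (simp flip: qscalar_mult)
  have "q * qinv q = qscalar (inverse (qnorm2 q)) * (q * qconj q)"
    unfolding qinv_def mult.assoc[symmetric] qscalar_commute[of q] ..
  then show "q * qinv q = 1" unfolding mult_qconj 1 .
  show "qinv q * q = 1"
    unfolding qinv_def mult.assoc mult_qconj 1 ..
qed

fun qinner :: "'a::comm_ring_1 quat \<Rightarrow> 'a quat \<Rightarrow> 'a" where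
  "qinner (Quat a b c d) (Quat a' b' c' d') = a * a' + b * b' + c * c' + d * d'"

lemma qnorm2_add: "qnorm2 (p + q) = qnorm2 p + 2 * qinner p q + qnorm2 q"
  by (cases p; cases q) (simp add: power2_eq_square algebra_simps)

lemma qinner_adjoint: "qinner p (c * q) = qinner (p * qconj q) c"
  by (cases p; cases q; cases c) (simp add: algebra_simps)

lemma qinner_add_left: "qinner (p + p') q = qinner p q + qinner p' q"
  by (cases p; cases p'; cases q) (simp add: algebra_simps)

lemma qinner_scalar_right: "qinner p (qscalar r * q) = r * qinner p q"
  by (cases p; cases q) (simp add: algebra_simps qscalar_def)

definition qdet :: "'a::comm_ring_1 quat \<Rightarrow> 'a quat \<Rightarrow> 'a quat \<Rightarrow> 'a quat \<Rightarrow> 'a" where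
  "qdet x y z w = (qnorm2 x + qnorm2 y) * (qnorm2 z + qnorm2 w) - qnorm2 (x * qconj z + y * qconj w)"

lemma qdet_swap_rows: "qdet z w x y = qdet x y z w"
proof -
  have "qnorm2 (z * qconj x + w * qconj y) = qnorm2 (qconj (x * qconj z + y * qconj w))"
    by (simp only: qconj_add qconj_mult qconj_qconj)
  then show ?thesis by (simp add: qdet_def)
qed

text \<open>
  With \<open>N\<close> the norm of the second row and \<open>p\<close> the product of the rows, the first norm grows by \<open>2 qinner p c + qnorm2 c * N\<close> and
  \<open>p\<close> becomes \<open>p + N c\<close>; the changes cancel as for a real Gram determinant, the non-commutativity being
  confined to the adjunction \<open>qinner_adjoint\<close>.
\<close>
lemma qdet_add_row: "qdet (x + c * z) (y + c * w) z w = qdet x y z w"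
proof -
  define p N where "p = x * qconj z + y * qconj w" and "N = qnorm2 z + qnorm2 w"
  have "qnorm2 (x + c * z) + qnorm2 (y + c * w) = qnorm2 x + qnorm2 y + 2 * qinner p c + qnorm2 c * N"
    by (simp add: qnorm2_add qinner_adjoint qnorm2_mult p_def N_def qinner_add_left algebra_simps)
  moreover have "(x + c * z) * qconj z + (y + c * w) * qconj w = p + qscalar N * c"
  proof -
    have "(x + c * z) * qconj z + (y + c * w) * qconj w = p + (c * (z * qconj z) + c * (w * qconj w))"
      by (simp add: p_def algebra_simps)
    also have "c * (z * qconj z) + c * (w * qconj w) = qscalar N * c"
      unfolding mult_qconj qscalar_commute by (cases c) (simp add: N_def qscalar_def algebra_simps)
    finally show ?thesis .
  qed
  ultimately show ?thesis
    by (simp add: qdet_def qnorm2_add qinner_scalar_right qnorm2_mult p_def[symmetric] N_def[symmetric])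
      (simp add: power2_eq_square algebra_simps)
qed

lemma qdet_add_row': "qdet x y (z + c * x) (w + c * y) = qdet x y z w"
  using qdet_add_row[of z c x w y] by (simp add: qdet_swap_rows)

fun qcoord :: "'a quat \<Rightarrow> nat \<Rightarrow> 'a" where
  "qcoord (Quat a b c d) i = (if i = 0 then a else if i = 1 then b else if i = 2 then c else d)"

text \<open>The matrix with rows \<open>(x, y)\<close> and \<open>(z, w)\<close>, in the coordinates of the sixteen real indeterminates.\<close>
definition mat_vec :: "real quat \<Rightarrow> real quat \<Rightarrow> real quat \<Rightarrow> real quat \<Rightarrow> nat \<Rightarrow> real" where
  "mat_vec x y z w i = (if i < 16 then qcoord (if i < 4 then x else if i < 8 then y else if i < 12 then z else w) (i mod 4) else 0)"

lemma mat_vec_in_vecs [simp]: "mat_vec x y z w \<in> vecs 16"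
  by (simp add: vecs_def mat_vec_def)

lemma qcoord_add: "qcoord (p + q) i = qcoord p i + qcoord q i" for p q :: "real quat"
  by (cases p; cases q) simp

lemma qcoord_scale: "qcoord (qscalar t * q) i = t * qcoord q i"
  by (cases q) (simp add: qscalar_def)

lemma mat_vec_line:
  "mat_vec (x + qscalar t * x') (y + qscalar t * y') (z + qscalar t * z') (w + qscalar t * w')
    = (\<lambda>i. mat_vec x y z w i + t * mat_vec x' y' z' w' i)"
  by (rule ext) (simp add: mat_vec_def qcoord_add qcoord_scale)

lemma mat_vec_scale:
  "mat_vec (qscalar t * x) (qscalar t * y) (qscalar t * z) (qscalar t * w) = (\<lambda>i. t * mat_vec x y z w i)"
  by (rule ext) (simp add: mat_vec_def qcoord_scale)

section \<open>Extremality of the determinant\<close>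

lemma bounded_poly_constant:
  fixes q :: "real poly"
  assumes "\<And>t. \<bar>poly q t\<bar> \<le> M"
  shows "poly q s = poly q t"
proof -
  obtain a r where q: "q = pCons a r" by (cases q)
  have "r = 0"
  proof (rule ccontr)
    assume "r \<noteq> 0"
    then obtain b where b: "\<And>z::real. b \<le> norm z \<Longrightarrow> M + 1 \<le> norm (poly (pCons a r) z)"
      using poly_infinity[of r "M + 1" a] by blast
    have "M + 1 \<le> norm (poly q \<bar>b\<bar>)" unfolding q by (rule b) simp
    then show False using assms[of "\<bar>b\<bar>"] by simp
  qed
  then show ?thesis by (simp add: q)
qed

lemma orthogonal_pair:
  fixes d0 d1 :: real
  obtains a0 a1 where "a0\<^sup>2 + a1\<^sup>2 = 1" "a0 * d0 + a1 * d1 = 0"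
proof (cases "d0\<^sup>2 + d1\<^sup>2 = 0")
  case True
  then have "d0 = 0" by (simp add: sum_power2_eq_zero_iff)
  with True show ?thesis using that[of 1 0] by simp
next
  case False
  define s where "s = sqrt (d0\<^sup>2 + d1\<^sup>2)"
  have "s\<^sup>2 = d0\<^sup>2 + d1\<^sup>2" "s \<noteq> 0" using False by (auto simp: s_def)
  then have "(- d1 / s)\<^sup>2 + (d0 / s)\<^sup>2 = 1"
    using False by (simp add: power_divide add_divide_distrib[symmetric] add.commute)
  moreover have "- d1 / s * d0 + d0 / s * d1 = 0" by simp
  ultimately show ?thesis by (rule that)
qed

text \<open>
  A unit quaternion is a product \<open>a * b\<close> of two purely imaginary units: take \<open>a\<close> orthogonal to the imaginary part of \<open>q\<close>. Both
  factors square to \<open>- 1\<close>, and \<open>u = a - b\<close> satisfies \<open>u * a = - b * u\<close>, so \<open>b\<close> is the conjugate by \<open>u\<close> of the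
  inverse of \<open>a\<close>. Only \<open>a = b\<close>, that is \<open>q = - 1\<close>, needs another \<open>u\<close>.
\<close>
lemma unit_quat_commutator:
  fixes q :: "real quat"
  assumes "qnorm2 q = 1"
  obtains a a' u u' where "a * a' = 1" "a' * a = 1" "u * u' = 1" "u' * u = 1" "q = a * u * a' * u'"
proof (cases "q = - 1")
  case True
  show ?thesis
    by (rule that[of "Quat 0 1 0 0" "Quat 0 (-1) 0 0" "Quat 0 0 1 0" "Quat 0 0 (-1) 0"])
      (simp_all add: True one_quat_def)
next
  case False
  obtain q0 q1 q2 q3 where q: "q = Quat q0 q1 q2 q3" by (cases q)
  obtain a1 a2 where a12: "a1\<^sup>2 + a2\<^sup>2 = 1" "a1 * q1 + a2 * q2 = 0"
    by (rule orthogonal_pair)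
  define a where "a = Quat 0 a1 a2 0"
  define b where "b = - a * q"
  have aa: "a * a = - 1"
    using a12 by (simp add: a_def one_quat_def power2_eq_square)
  have ab: "a * b = q"
    using aa by (simp add: b_def mult.assoc[symmetric])
  have "qconj b = - b"
    using a12 by (simp add: b_def a_def q)
  then have "b * b = - (b * qconj b)" by simp
  moreover have "qnorm2 b = 1"
    using assms a12 by (simp add: b_def qnorm2_mult a_def)
  ultimately have bb: "b * b = - 1"
    by (simp add: mult_qconj)
  define u where "u = a - b"
  have "u \<noteq> 0"
  proof
    assume "u = 0"
    then have "a = b" by (simp add: u_def)
    then show False using False aa ab by simp
  qed
  have conj: "u * a = - b * u"
    by (simp add: u_def algebra_simps aa bb)
  have "a * u * - a * qinv u = - (a * (u * a) * qinv u)"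
    by (simp add: mult.assoc)
  also have "\<dots> = a * b * (u * qinv u)"
    unfolding conj by (simp add: mult.assoc)
  also have "\<dots> = q"
    unfolding ab qinv(1)[OF \<open>u \<noteq> 0\<close>] by simp
  finally have "q = a * u * - a * qinv u" ..
  moreover have "a * - a = 1" "- a * a = 1" by (simp_all add: aa)
  ultimately show ?thesis
    using that[of a "- a" u "qinv u"] qinv[OF \<open>u \<noteq> 0\<close>] by (simp only:)
qed

text \<open>
  A row operation with parameter \<open>c\<close> is the end of a line on which the determinant is constant; there \<open>h\<close> is a
  bounded polynomial, hence constant, so row operations leave \<open>h\<close> fixed. As for matrices over any ring, they generate
  the matrices with diagonal \<open>u\<close>, \<open>u\<close> inverse, and three of these compose to the matrix with diagonal \<open>1\<close> and
  a commutator. So \<open>h\<close> at the diagonal matrix with entries \<open>1\<close>, \<open>q\<close> depends on the norm of \<open>q\<close> only, and elimination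
  reduces every matrix of non-zero determinant to this case. Where the determinant
  vanishes, so does \<open>h\<close> by its bounds.
\<close>
lemma qdet_extremal:
  assumes f: "form_fun 4 f F"
    and nonneg: "\<And>x y z w. 0 \<le> f (mat_vec x y z w)"
    and bound: "\<And>x y z w. f (mat_vec x y z w) \<le> K * qdet x y z w"
  shows "f (mat_vec x y z w) = f (mat_vec 1 0 0 1) * qdet x y z w"
proof -
  define h where "h = (\<lambda>x y z w. f (mat_vec x y z w))"
  have line: "h (x + x') (y + y') (z + z') (w + w') = h x y z w"
    if "\<And>t. qdet (x + qscalar t * x') (y + qscalar t * y') (z + qscalar t * z') (w + qscalar t * w') = qdet x y z w"
    for x y z w x' y' z' w'
  proof -
    obtain q where q: "\<And>t. f (\<lambda>i. mat_vec x y z w i + t * mat_vec x' y' z' w' i) = poly q t"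
      using form_fun_real_line[OF f] by metis
    then have q': "h (x + qscalar t * x') (y + qscalar t * y') (z + qscalar t * z') (w + qscalar t * w') = poly q t" for t
      by (simp add: h_def mat_vec_line)
    have "\<bar>poly q t\<bar> \<le> K * qdet x y z w" for t
      using nonneg bound that[of t] unfolding q'[symmetric] h_def by (metis abs_of_nonneg)
    then have "poly q 1 = poly q 0" by (rule bounded_poly_constant)
    then show ?thesis using q'[of 0] q'[of 1] by simp
  qed
  have row1: "h (x + c * z) (y + c * w) z w = h x y z w" for x y z w c
    using line[of x "c * z" y "c * w" z 0 w 0] by (simp add: qdet_add_row mult.assoc[symmetric])
  have row2: "h x y (z + c * x) (w + c * y) = h x y z w" for x y z w c
    using line[of x 0 y 0 z "c * x" w "c * y"] by (simp add: qdet_add_row' mult.assoc[symmetric])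
  \<comment> \<open>Whitehead's lemma: three row operations exchange the rows up to the factors \<open>u\<close> and \<open>- u'\<close>.\<close>
  have swap: "h (u * z) (u * w) (- u' * x) (- u' * y) = h x y z w" if "u * u' = 1" "u' * u = 1" for x y z w u u'
  proof -
    have 1: "z + - u' * (x + u * z) = - u' * x" for x z
      using that by (simp add: distrib_left mult.assoc[symmetric])
    have 2: "x + u * z + u * (- u' * x) = u * z" for x z
      using that by (simp add: mult.assoc[symmetric])
    have "h x y z w = h (x + u * z) (y + u * w) (z + - u' * (x + u * z)) (w + - u' * (y + u * w))"
      by (simp only: row1 row2)
    also have "\<dots> = h (x + u * z) (y + u * w) (- u' * x) (- u' * y)"
      by (simp only: 1)
    also have "\<dots> = h (x + u * z + u * (- u' * x)) (y + u * w + u * (- u' * y)) (- u' * x) (- u' * y)"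
      by (simp only: row1)
    also have "\<dots> = h (u * z) (u * w) (- u' * x) (- u' * y)"
      by (simp only: 2)
    finally show ?thesis ..
  qed
  have diag: "h (u * x) (u * y) (u' * z) (u' * w) = h x y z w" if "u * u' = 1" "u' * u = 1" for x y z w u u'
    using swap[OF that, of x y "- z" "- w"] swap[of "-1" "-1" z w x y] by simp
  have comm: "h x y (a * u * a' * u' * z) (a * u * a' * u' * w) = h x y z w"
    if "a * a' = 1" "a' * a = 1" "u * u' = 1" "u' * u = 1" for x y z w a a' u u'
  proof -
    have inv: "(u' * a') * (a * u) = 1" "(a * u) * (u' * a') = 1"
      using that by (metis mult.assoc mult.right_neutral)+
    have "h x y z w = h (a * (u * x)) (a * (u * y)) (a' * (u' * z)) (a' * (u' * w))"
      using diag[OF that(1,2)] diag[OF that(3,4)] by simp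
    also have "\<dots> = h (u' * a' * (a * (u * x))) (u' * a' * (a * (u * y))) (a * u * (a' * (u' * z))) (a * u * (a' * (u' * w)))"
      using diag[OF inv] by simp
    also have "\<dots> = h x y (a * u * (a' * (u' * z))) (a * u * (a' * (u' * w)))"
      using inv(1) by (simp only: mult.assoc[symmetric] mult_1_left)
    finally show ?thesis by (simp only: mult.assoc)
  qed
  have diag_one: "h 1 0 0 q = h 1 0 0 1 * qnorm2 q" if "q \<noteq> 0" for q
  proof -
    define r where "r = sqrt (sqrt (qnorm2 q))"
    have r: "r > 0" "r ^ 4 = qnorm2 q"
    proof -
      show "r > 0" using that by (simp add: r_def)
      have "r ^ 4 = (r\<^sup>2)\<^sup>2" by simp
      then show "r ^ 4 = qnorm2 q" by (simp add: r_def)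
    qed
    define q' where "q' = qscalar (inverse (r\<^sup>2)) * q"
    have "qnorm2 q' = 1"
    proof -
      have "(inverse (r\<^sup>2))\<^sup>2 = inverse (r ^ 4)" by (simp add: power_inverse)
      then show ?thesis
        using that by (simp add: q'_def qnorm2_mult r(2))
    qed
    then obtain a a' u u' where "a * a' = 1" "a' * a = 1" "u * u' = 1" "u' * u = 1" "q' = a * u * a' * u'"
      by (rule unit_quat_commutator)
    then have q': "h 1 0 0 q' = h 1 0 0 1"
      using comm[of a a' u u' 1 0 0 1] by simp
    have "qscalar r * qscalar (inverse r) = 1" "qscalar (inverse r) * qscalar r = 1"
      using r by (simp_all flip: qscalar_mult)
    from diag[OF this, of 1 0 0 q]
    have D: "h (qscalar r) 0 0 (qscalar (inverse r) * q) = h 1 0 0 q" by simp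
    have "h 1 0 0 q = h (qscalar r * 1) (qscalar r * 0) (qscalar r * 0) (qscalar r * q')"
    proof -
      have "r * inverse (r\<^sup>2) = inverse r" using r(1) by (simp add: power2_eq_square)
      then have "qscalar r * q' = qscalar (inverse r) * q"
        unfolding q'_def mult.assoc[symmetric] qscalar_mult[symmetric] by simp
      then show ?thesis using D by simp
    qed
    also have "\<dots> = r ^ 4 * h 1 0 0 q'"
      unfolding h_def mat_vec_scale form_fun_homogeneous(1)[OF f] ..
    finally show ?thesis using q' r by simp
  qed
  have zero: "h x y z w = 0" if "qdet x y z w = 0" for x y z w
    using nonneg[of x y z w] bound[of x y z w] that by (simp add: h_def)
  have main: "h x y z w = h 1 0 0 1 * qdet x y z w" if "x \<noteq> 0" for x y z w
  proof -
    note x = qinv[OF that]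
    define \<delta> where "\<delta> = w + - (z * qinv x) * y"
    have z0: "z + - (z * qinv x) * x = 0"
      using x by (simp add: mult.assoc)
    have h: "h x y z w = h x y 0 \<delta>" and q: "qdet x y z w = qdet x y 0 \<delta>"
      using row2[of x y z "- (z * qinv x)" w] qdet_add_row'[of x y z "- (z * qinv x)" w] z0
      by (simp_all add: \<delta>_def)
    show ?thesis
    proof (cases "\<delta> = 0")
      case True
      then have "qdet x y z w = 0" unfolding q by (simp add: qdet_def)
      then show ?thesis using zero by simp
    next
      case False
      note \<delta> = qinv[OF False]
      have y0: "y + - (y * qinv \<delta>) * \<delta> = 0"
        using \<delta> by (simp add: mult.assoc)
      have h': "h x y 0 \<delta> = h x 0 0 \<delta>" and q': "qdet x y 0 \<delta> = qdet x 0 0 \<delta>"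
        using row1[of x "- (y * qinv \<delta>)" 0 y \<delta>] qdet_add_row[of x "- (y * qinv \<delta>)" 0 y \<delta>] y0
        by simp_all
      have "h x 0 0 \<delta> = h 1 0 0 (x * \<delta>)"
        using diag[of "qinv x" x x 0 0 \<delta>] x by simp
      also have "\<dots> = h 1 0 0 1 * qnorm2 (x * \<delta>)"
      proof (rule diag_one)
        have "qnorm2 (x * \<delta>) \<noteq> 0" using False that by (simp add: qnorm2_mult del: qnorm2_eq_0_iff) simp
        then show "x * \<delta> \<noteq> 0" by auto
      qed
      also have "qnorm2 (x * \<delta>) = qdet x 0 0 \<delta>"
        by (simp add: qdet_def qnorm2_mult)
      finally show ?thesis by (simp add: h h' q q')
    qed
  qed
  have "h x y z w = h 1 0 0 1 * qdet x y z w"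
  proof (cases "x = 0")
    case True
    show ?thesis
    proof (cases "z = 0")
      case True
      have "qdet x y z w = 0"
        using \<open>x = 0\<close> True by (simp add: qdet_def qnorm2_mult)
      then show ?thesis using zero by simp
    next
      case False
      then show ?thesis
        using main[of z "y + w" z w] row1[of x 1 z y w] qdet_add_row[of x 1 z y w] True by simp
    qed
  qed (rule main)
  then show ?thesis by (simp add: h_def)
qed

section \<open>Factorizations on hyperplanes\<close>

text \<open>
  At a common zero of \<open>B\<close> and \<open>C\<close>, the lowest order term of the product in direction \<open>v\<close> is the product of the two
  derivatives. It must equal \<open>\<kappa> > 0\<close>, but in a plane of directions some \<open>v\<close> annihilates the derivative of \<open>B\<close>.
\<close>
lemma factors_not_both_zero:
  assumes B: "quadratic_form B" and C: "quadratic_form C"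
    and prod: "\<And>\<alpha> \<beta> s. B (\<lambda>i. x i + s * (\<alpha> * y i + \<beta> * z i)) * C (\<lambda>i. x i + s * (\<alpha> * y i + \<beta> * z i))
      = s\<^sup>2 * \<kappa> \<alpha> \<beta>"
    and pos: "\<And>\<alpha> \<beta>. (\<alpha>, \<beta>) \<noteq> (0, 0) \<Longrightarrow> \<kappa> \<alpha> \<beta> > (0::real)"
  shows "B x \<noteq> 0 \<or> C x \<noteq> 0"
proof (rule ccontr)
  assume "\<not> (B x \<noteq> 0 \<or> C x \<noteq> 0)"
  then have zero: "B x = 0" "C x = 0" by auto
  obtain b where b: "bilinear_form b" "\<And>x y s. B (\<lambda>i. x i + s * y i) = B x + s * b x y + s\<^sup>2 * B y"
    using quadratic_form_line[OF B] by metis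
  obtain c where c: "bilinear_form c" "\<And>x y s. C (\<lambda>i. x i + s * y i) = C x + s * c x y + s\<^sup>2 * C y"
    using quadratic_form_line[OF C] by metis
  have lin: "b x (\<lambda>i. \<alpha> * y i + \<beta> * z i) = \<alpha> * b x y + \<beta> * b x z" for \<alpha> \<beta>
    using b(1) linear_formD[of "b x" "\<lambda>i. \<alpha> * y i" \<beta> z] linear_form_scale[of "b x" \<alpha> y]
    by (simp add: bilinear_form_def)
  \<comment> \<open>A direction in the plane of \<open>y\<close> and \<open>z\<close> that annihilates the derivative of \<open>B\<close> at \<open>x\<close>.\<close>
  obtain \<alpha> \<beta> where \<alpha>\<beta>: "(\<alpha>, \<beta>) \<noteq> (0, 0)" "\<alpha> * b x y + \<beta> * b x z = 0"
  proof (cases "b x y = 0 \<and> b x z = 0")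
    case True
    then show ?thesis using that[of 1 1] by simp
  next
    case False
    then show ?thesis using that[of "b x z" "- b x y"] by (auto simp: algebra_simps)
  qed
  define v where "v = (\<lambda>i. \<alpha> * y i + \<beta> * z i)"
  have "b x v = 0" using lin[of \<alpha> \<beta>] \<alpha>\<beta>(2) by (simp add: v_def)
  moreover have "B (\<lambda>i. x i + s * v i) * C (\<lambda>i. x i + s * v i) = s\<^sup>2 * \<kappa> \<alpha> \<beta>" for s
    using prod[of s \<alpha> \<beta>] by (simp only: v_def)
  ultimately have *: "(s\<^sup>2 * B v) * (s * c x v + s\<^sup>2 * C v) = s\<^sup>2 * \<kappa> \<alpha> \<beta>" for s
    unfolding b(2) c(2) zero by simp
  have "B v * c x v + B v * C v = \<kappa> \<alpha> \<beta>"
    using *[of 1] by (simp add: algebra_simps)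
  moreover have "- (B v * c x v) + B v * C v = \<kappa> \<alpha> \<beta>"
    using *[of "-1"] by (simp add: algebra_simps)
  moreover have "8 * (B v * c x v) + 16 * (B v * C v) = 4 * \<kappa> \<alpha> \<beta>"
    using *[of 2] by (simp add: algebra_simps)
  ultimately have "\<kappa> \<alpha> \<beta> = 0" by linarith
  then show False using pos[OF \<alpha>\<beta>(1)] by simp
qed

text \<open>
  If \<open>B\<close> vanished at both points, it would be \<open>s t\<close> times a constant on their span, and the monomial \<open>s t\<^sup>3\<close>, absent
  from the product, would force that constant or \<open>C x\<close> to be zero. Both are excluded, the former by \<open>\<kappa> \<noteq> 0\<close>.
\<close>
lemma no_common_zero_of_factor:
  assumes B: "quadratic_form B" and C: "quadratic_form C"
    and prod: "\<And>s t. B (\<lambda>i. t * x i + s * y i) * C (\<lambda>i. t * x i + s * y i) = s\<^sup>2 * t\<^sup>2 * \<kappa>"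
    and "\<kappa> \<noteq> 0" "B x = 0" "C x \<noteq> 0"
  shows "B y \<noteq> 0"
proof
  assume "B y = 0"
  obtain b where b: "bilinear_form b" "\<And>x y s. B (\<lambda>i. x i + s * y i) = B x + s * b x y + s\<^sup>2 * B y"
    using quadratic_form_line[OF B] by metis
  obtain c where c: "bilinear_form c" "\<And>x y s. C (\<lambda>i. x i + s * y i) = C x + s * c x y + s\<^sup>2 * C y"
    using quadratic_form_line[OF C] by metis
  have "B (\<lambda>i. x i + s * y i) * C (\<lambda>i. x i + s * y i) = s\<^sup>2 * \<kappa>" for s
    using prod[of 1 s] by simp
  then have *: "s * b x y * (C x + s * c x y + s\<^sup>2 * C y) = s\<^sup>2 * \<kappa>" for s
    unfolding b(2) c(2) \<open>B x = 0\<close> \<open>B y = 0\<close> by simp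
  have "b x y * C x + b x y * c x y + b x y * C y = \<kappa>"
    using *[of 1] by (simp add: algebra_simps)
  moreover have "- (b x y * C x) + b x y * c x y - b x y * C y = \<kappa>"
    using *[of "-1"] by (simp add: algebra_simps)
  moreover have "2 * (b x y * C x) + 4 * (b x y * c x y) + 8 * (b x y * C y) = 4 * \<kappa>"
    using *[of 2] by (simp add: algebra_simps)
  ultimately have "b x y * C x = 0" "b x y * c x y = \<kappa>"
    by linarith+
  then show False using assms(4,6) by auto
qed

text \<open>
  A linear form on a real plane has a unit vector in its kernel. One such vector is taken from the span of \<open>1\<close> and \<open>i\<close>, the other from
  the span of \<open>j\<close> and \<open>k\<close>, so that they are orthogonal.
\<close>
lemma linear_form_quat_kernel:
  fixes l :: "real quat \<Rightarrow> real"
  assumes l: "\<And>p q t. l (p + qscalar t * q) = l p + t * l q"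
  obtains p q where "l p = 0" "l q = 0" "\<And>\<alpha> \<beta>. qnorm2 (qscalar \<alpha> * p + qscalar \<beta> * q) = \<alpha>\<^sup>2 + \<beta>\<^sup>2"
proof -
  have l0: "l 0 = 0" using l[of 0 1 0] by simp
  have l_eq: "l (Quat a b c d) = a * l (Quat 1 0 0 0) + b * l (Quat 0 1 0 0) + c * l (Quat 0 0 1 0) + d * l (Quat 0 0 0 1)" for a b c d
  proof -
    have "Quat a b c d = 0 + qscalar a * Quat 1 0 0 0 + qscalar b * Quat 0 1 0 0
      + qscalar c * Quat 0 0 1 0 + qscalar d * Quat 0 0 0 1"
      by (simp add: qscalar_def zero_quat_def)
    then show ?thesis by (simp only: l l0)
  qed
  obtain a0 a1 where a: "a0\<^sup>2 + a1\<^sup>2 = 1" "a0 * l (Quat 1 0 0 0) + a1 * l (Quat 0 1 0 0) = 0"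
    by (rule orthogonal_pair)
  obtain a2 a3 where a': "a2\<^sup>2 + a3\<^sup>2 = 1" "a2 * l (Quat 0 0 1 0) + a3 * l (Quat 0 0 0 1) = 0"
    by (rule orthogonal_pair)
  show ?thesis
  proof (rule that[of "Quat a0 a1 0 0" "Quat 0 0 a2 a3"])
    show "l (Quat a0 a1 0 0) = 0" "l (Quat 0 0 a2 a3) = 0"
      using a a' l_eq[of a0 a1 0 0] l_eq[of 0 0 a2 a3] by simp_all
    fix \<alpha> \<beta>
    have "qnorm2 (qscalar \<alpha> * Quat a0 a1 0 0 + qscalar \<beta> * Quat 0 0 a2 a3)
      = \<alpha>\<^sup>2 * (a0\<^sup>2 + a1\<^sup>2) + \<beta>\<^sup>2 * (a2\<^sup>2 + a3\<^sup>2)"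
      by (simp add: qscalar_def power_mult_distrib algebra_simps)
    then show "qnorm2 (qscalar \<alpha> * Quat a0 a1 0 0 + qscalar \<beta> * Quat 0 0 a2 a3) = \<alpha>\<^sup>2 + \<beta>\<^sup>2"
      using a a' by simp
  qed
qed

lemma qdet_corner: "qdet (a + x) a a a = qnorm2 a * qnorm2 x" "qdet a a a (a + x) = qnorm2 a * qnorm2 x"
proof -
  have "qdet (a + x) a a a = qdet x 0 a a"
    using qdet_add_row[of x 1 a 0 a] by (simp add: add.commute)
  then show "qdet (a + x) a a a = qnorm2 a * qnorm2 x"
    by (simp add: qdet_def qnorm2_mult algebra_simps)
  have "qdet a a a (a + x) = qdet a a 0 x"
    using qdet_add_row'[of a a 0 1 x] by (simp add: add.commute)
  then show "qdet a a a (a + x) = qnorm2 a * qnorm2 x"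
    by (simp add: qdet_def qnorm2_mult algebra_simps)
qed

lemma qdet_diag: "qdet x 0 0 w = qnorm2 x * qnorm2 w"
  by (simp add: qdet_def qnorm2_mult)

text \<open>
  The hyperplane contains three singular matrices \<open>P x\<close>, \<open>R w\<close>, \<open>A a\<close> whose pairwise combinations
  \<open>s M + t N\<close> have determinant \<open>s\<^sup>2 t\<^sup>2\<close>, together with a plane of further choices for \<open>x\<close> and for \<open>w\<close>. At each of
  the three points one of the factors \<open>B\<close>, \<open>C\<close> vanishes, but not both, by \<open>factors_not_both_zero\<close>. So one and the same
  factor vanishes at two of them, against \<open>no_common_zero_of_factor\<close>.
\<close>
lemma qdet_not_product_on_hyperplane:
  assumes B: "quadratic_form B" and C: "quadratic_form C" and D: "linear_form D" and "c > 0"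
    and prod: "\<And>x y z w. D (mat_vec x y z w) = 0 \<Longrightarrow>
      B (mat_vec x y z w) * C (mat_vec x y z w) = c * qdet x y z w"
  shows False
proof -
  define P where "P = (\<lambda>x. mat_vec x 0 0 0)"
  define R where "R = (\<lambda>w. mat_vec 0 0 0 w)"
  define A where "A = (\<lambda>a. mat_vec a a a a)"
  have P: "P (p + qscalar t * q) = (\<lambda>i. P p i + t * P q i)"
    and R: "R (p + qscalar t * q) = (\<lambda>i. R p i + t * R q i)"
    and A: "A (p + qscalar t * q) = (\<lambda>i. A p i + t * A q i)" for p q t
    using mat_vec_line[of p t q 0 0 0 0 0 0] mat_vec_line[of 0 t 0 0 0 0 0 p q] mat_vec_line[of p t q p q p q p q]
    by (simp_all add: P_def R_def A_def)
  obtain x x' where x: "D (P x) = 0" "D (P x') = 0" "\<And>\<alpha> \<beta>. qnorm2 (qscalar \<alpha> * x + qscalar \<beta> * x') = \<alpha>\<^sup>2 + \<beta>\<^sup>2"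
    by (rule linear_form_quat_kernel[of "\<lambda>q. D (P q)"]) (auto simp: P linear_formD[OF D])
  obtain w w' where w: "D (R w) = 0" "D (R w') = 0" "\<And>\<alpha> \<beta>. qnorm2 (qscalar \<alpha> * w + qscalar \<beta> * w') = \<alpha>\<^sup>2 + \<beta>\<^sup>2"
    by (rule linear_form_quat_kernel[of "\<lambda>q. D (R q)"]) (auto simp: R linear_formD[OF D])
  obtain a a' where a: "D (A a) = 0" "D (A a') = 0" "\<And>\<alpha> \<beta>. qnorm2 (qscalar \<alpha> * a + qscalar \<beta> * a') = \<alpha>\<^sup>2 + \<beta>\<^sup>2"
    by (rule linear_form_quat_kernel[of "\<lambda>q. D (A q)"]) (auto simp: A linear_formD[OF D])
  have norms: "qnorm2 x = 1" "qnorm2 w = 1" "qnorm2 a = 1"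
    using x(3)[of 1 0] w(3)[of 1 0] a(3)[of 1 0] by simp_all
  have val: "B (\<lambda>i. r * P x i + r' * P x' i + s * R w i + s' * R w' i + t * A a i)
      * C (\<lambda>i. r * P x i + r' * P x' i + s * R w i + s' * R w' i + t * A a i)
    = c * qdet (qscalar t * a + (qscalar r * x + qscalar r' * x')) (qscalar t * a) (qscalar t * a)
        (qscalar t * a + (qscalar s * w + qscalar s' * w'))" for r r' s s' t
  proof -
    have eq: "mat_vec (qscalar t * a + (qscalar r * x + qscalar r' * x')) (qscalar t * a) (qscalar t * a)
        (qscalar t * a + (qscalar s * w + qscalar s' * w'))
      = (\<lambda>i. r * P x i + r' * P x' i + s * R w i + s' * R w' i + t * A a i)"
      by (rule ext) (simp add: P_def R_def A_def mat_vec_def qcoord_add qcoord_scale zero_quat_def)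
    have "D (\<lambda>i. r * P x i + r' * P x' i + s * R w i + s' * R w' i + t * A a i) = 0"
      using x(1,2) w(1,2) a(1) by (simp add: linear_formD[OF D] linear_form_scale[OF D])
    then show ?thesis using prod unfolding eq[symmetric] by blast
  qed
  have nz: "B (P x) \<noteq> 0 \<or> C (P x) \<noteq> 0" "B (R w) \<noteq> 0 \<or> C (R w) \<noteq> 0" "B (A a) \<noteq> 0 \<or> C (A a) \<noteq> 0"
  proof -
    have pos: "c * (\<alpha>\<^sup>2 + \<beta>\<^sup>2) > 0" if "(\<alpha>, \<beta>) \<noteq> (0, 0)" for \<alpha> \<beta> :: real
      using that \<open>c > 0\<close> by (auto simp: sum_power2_gt_zero_iff)
    show "B (P x) \<noteq> 0 \<or> C (P x) \<noteq> 0"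
    proof (rule factors_not_both_zero[OF B C _ pos, of _ "R w" "R w'"])
      fix \<alpha> \<beta> s
      show "B (\<lambda>i. P x i + s * (\<alpha> * R w i + \<beta> * R w' i)) * C (\<lambda>i. P x i + s * (\<alpha> * R w i + \<beta> * R w' i)) = s\<^sup>2 * (c * (\<alpha>\<^sup>2 + \<beta>\<^sup>2))"
        using val[of 1 0 "s * \<alpha>" "s * \<beta>" 0] by (simp add: algebra_simps qdet_diag w(3) norms power_mult_distrib)
    qed auto
    show "B (R w) \<noteq> 0 \<or> C (R w) \<noteq> 0"
    proof (rule factors_not_both_zero[OF B C _ pos, of _ "P x" "P x'"])
      fix \<alpha> \<beta> s
      show "B (\<lambda>i. R w i + s * (\<alpha> * P x i + \<beta> * P x' i)) * C (\<lambda>i. R w i + s * (\<alpha> * P x i + \<beta> * P x' i)) = s\<^sup>2 * (c * (\<alpha>\<^sup>2 + \<beta>\<^sup>2))"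
        using val[of "s * \<alpha>" "s * \<beta>" 1 0 0] by (simp add: algebra_simps qdet_diag x(3) norms power_mult_distrib)
    qed auto
    show "B (A a) \<noteq> 0 \<or> C (A a) \<noteq> 0"
    proof (rule factors_not_both_zero[OF B C _ pos, of _ "P x" "P x'"])
      fix \<alpha> \<beta> s
      show "B (\<lambda>i. A a i + s * (\<alpha> * P x i + \<beta> * P x' i)) * C (\<lambda>i. A a i + s * (\<alpha> * P x i + \<beta> * P x' i)) = s\<^sup>2 * (c * (\<alpha>\<^sup>2 + \<beta>\<^sup>2))"
        using val[of "s * \<alpha>" "s * \<beta>" 0 0 1] by (simp add: qdet_corner x(3) norms power_mult_distrib) (simp add: algebra_simps)
    qed auto
  qed
  have zero: "B (P x) * C (P x) = 0" "B (R w) * C (R w) = 0" "B (A a) * C (A a) = 0"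
    using val[of 1 0 0 0 0] val[of 0 0 1 0 0] val[of 0 0 0 0 1] by (simp_all add: qdet_diag qdet_corner[of a 0, simplified])
  have PR: "B (\<lambda>i. t * P x i + s * R w i) * C (\<lambda>i. t * P x i + s * R w i) = s\<^sup>2 * t\<^sup>2 * c" for s t
    using val[of t 0 s 0 0] by (simp add: qdet_diag qnorm2_mult norms)
  have AP: "B (\<lambda>i. t * A a i + s * P x i) * C (\<lambda>i. t * A a i + s * P x i) = s\<^sup>2 * t\<^sup>2 * c" for s t
    using val[of s 0 0 0 t] by (simp add: qdet_corner qnorm2_mult norms) (simp add: add.commute)
  have AR: "B (\<lambda>i. t * A a i + s * R w i) * C (\<lambda>i. t * A a i + s * R w i) = s\<^sup>2 * t\<^sup>2 * c" for s t
    using val[of 0 0 s 0 t] by (simp add: qdet_corner qnorm2_mult norms) (simp add: add.commute)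
  note clash = no_common_zero_of_factor[OF B C] no_common_zero_of_factor[OF C B]
  have "B (P x) = 0 \<Longrightarrow> B (R w) \<noteq> 0" "C (P x) = 0 \<Longrightarrow> C (R w) \<noteq> 0"
    using clash(1)[OF PR] clash(2)[of "P x" "R w" c] PR nz \<open>c > 0\<close> by (auto simp: mult.commute)
  moreover have "B (A a) = 0 \<Longrightarrow> B (P x) \<noteq> 0" "C (A a) = 0 \<Longrightarrow> C (P x) \<noteq> 0"
    using clash(1)[OF AP] clash(2)[of "A a" "P x" c] AP nz \<open>c > 0\<close> by (auto simp: mult.commute)
  moreover have "B (A a) = 0 \<Longrightarrow> B (R w) \<noteq> 0" "C (A a) = 0 \<Longrightarrow> C (R w) \<noteq> 0"
    using clash(1)[OF AR] clash(2)[of "A a" "R w" c] AR nz \<open>c > 0\<close> by (auto simp: mult.commute)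
  ultimately show False using zero by auto
qed

section \<open>Hyperwrons of degree four\<close>

text \<open>
  Doubling the argument multiplies a quartic by \<open>2 ^ 4\<close> and the hyperwron expression by \<open>2 ^ (k * (2 * (d - 1)))\<close>, which leaves
  only \<open>d = 3\<close> and \<open>d = 2\<close> unless both sides vanish identically. In the case \<open>d = 2\<close>, the expression is \<open>V (\<phi> x)\<close> for a positive
  semidefinite quadratic form \<open>V\<close>, and \<open>g x\<close> is twice the associated bilinear form at \<open>\<phi> x0\<close> and \<open>\<phi> x\<close>.
\<close>
lemma hyperwron_structure:
  assumes q: "q \<in> hyperwrons m 2"
  obtains
    (zero) "\<And>x. x \<in> vecs m \<Longrightarrow> eval q x = (0::real)"
  | (quadratic) "\<And>x. x \<in> vecs m \<Longrightarrow> eval q x \<ge> (0::real)"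
      "\<And>x0. x0 \<in> vecs m \<Longrightarrow> eval q x0 > (0::real) \<Longrightarrow> \<exists>g G. form_fun 2 g G \<and> g x0 = 2 * eval q x0 \<and>
        (\<forall>x\<in>vecs m. (g x)\<^sup>2 \<le> 4 * eval q x0 * eval q x)"
  | (cubic) B C D where "\<And>x. x \<in> vecs m \<Longrightarrow> eval q x \<ge> (0::real)"
      "quadratic_form B" "quadratic_form C" "linear_form D"
      "\<And>x. x \<in> vecs m \<Longrightarrow> D x = 0 \<Longrightarrow> eval q x = B x * C x"
proof -
  from q obtain k d n e p u v \<phi> where
    qm: "q \<in> forms m (2 * 2)" and "k > 0" "d > 0" and e: "e \<in> vecs n" and p: "p \<in> hyperbolic n d e"
    and u: "u \<in> hyp_cone n p e" and v: "v \<in> hyp_cone n p e" and \<phi>: "\<phi> \<in> form_maps m k n"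
    and W: "\<And>x. x \<in> vecs m \<Longrightarrow> eval q x = dir_deriv u (eval p) (eval_map \<phi> x) * dir_deriv v (eval p) (eval_map \<phi> x)
       - eval p (eval_map \<phi> x) * dir_deriv u (dir_deriv v (eval p)) (eval_map \<phi> x)"
    unfolding hyperwrons_def by blast
  define P :: "(nat \<Rightarrow> real) \<Rightarrow> real" where "P = eval p"
  define PC :: "(nat \<Rightarrow> complex) \<Rightarrow> complex" where "PC = eval p"
  have P: "form_fun d P PC"
    using p unfolding P_def PC_def by (auto simp: hyperbolic_def intro: form_fun_eval)
  define V where "V = (\<lambda>y. dir_deriv u P y * dir_deriv v P y - P y * dir_deriv u (dir_deriv v P) y)"
  have W: "eval q x = V (eval_map \<phi> x)" if "x \<in> vecs m" for x
    using W[OF that] by (simp add: V_def P_def)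
  have \<phi>_vecs: "eval_map \<phi> x \<in> vecs n" for x
    using \<phi> by (auto simp: form_maps_def vecs_def eval_map_def)
  have V_nonneg: "V y \<ge> 0" if "y \<in> vecs n" for y
    using Rayleigh_inequality[OF p e u v that] by (simp add: V_def P_def)
  have nonneg: "eval q x \<ge> (0::real)" if "x \<in> vecs m" for x
    using W[OF that] V_nonneg[OF \<phi>_vecs] by simp
  have \<Phi>: "form_fun k (\<lambda>x. eval_map \<phi> x i) (\<lambda>z. eval (\<phi> i) z)" for i
  proof (cases "i < n")
    case True
    then show ?thesis using \<phi> form_fun_eval[of "\<phi> i" m k] by (simp add: form_maps_def eval_map_def)
  next
    case False
    then show ?thesis using \<phi> form_fun.zero[of k] by (simp add: form_maps_def eval_map_def)
  qed
  obtain VC where V: "form_fun (2 * (d - 1)) V VC"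
    using form_fun_Wronskian[OF P \<open>d > 0\<close>, of u v] unfolding V_def by metis
  show ?thesis
  proof (cases "\<exists>x\<in>vecs m. eval q x \<noteq> (0::real)")
    case False
    then show ?thesis using zero by blast
  next
    case True
    then obtain x0 where x0: "x0 \<in> vecs m" "eval q x0 \<noteq> (0::real)" by blast
    have "(\<lambda>i. 2 * x0 i) \<in> vecs m" using x0 by (auto simp: vecs_def)
    then have "eval q (\<lambda>i. 2 * x0 i) = V (eval_map \<phi> (\<lambda>i. 2 * x0 i))" by (rule W)
    then have "2 ^ 4 * eval q x0 = 2 ^ (k * (2 * (d - 1))) * eval q x0"
      using form_fun_homogeneous(1)[OF form_fun_comp[OF V \<Phi>], of 2 x0]
        form_fun_homogeneous(1)[OF form_fun_eval[OF qm], of 2 x0] W[OF x0(1)] by simp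
    then have "(2::real) ^ 4 = 2 ^ (k * (2 * (d - 1)))" using x0(2) by (metis mult_cancel_right)
    then have "k * (2 * (d - 1)) = 4" by (metis one_less_numeral_iff power_inject_exp semiring_norm(76))
    then have kd: "k * (d - 1) = 2" by simp
    then have "k dvd 2" by (metis dvd_triv_left)
    then have "k \<le> 2" by (simp add: dvd_imp_le)
    then have "k = 1 \<or> k = 2" using \<open>k > 0\<close> by linarith
    then consider "k = 1" "d = 3" | "k = 2" "d = 2"
      using kd by auto
    then show ?thesis
    proof cases
      case 1
      note Du = form_fun_comp[OF form_fun_dir_deriv[OF P, of u] \<Phi>]
      note Dv = form_fun_comp[OF form_fun_dir_deriv[OF P, of v] \<Phi>]
      note Duv = form_fun_comp[OF form_fun_dir_deriv[OF form_fun_dir_deriv[OF P, of v], of u] \<Phi>]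
      show ?thesis
      proof (rule cubic[OF nonneg])
        show "quadratic_form (\<lambda>x. dir_deriv u P (eval_map \<phi> x))"
          "quadratic_form (\<lambda>x. dir_deriv v P (eval_map \<phi> x))"
          "linear_form (\<lambda>x. dir_deriv u (dir_deriv v P) (eval_map \<phi> x))"
          using form_fun_low_degree[OF Du] form_fun_low_degree[OF Dv] form_fun_low_degree[OF Duv] 1 by simp_all
      qed (auto simp: W V_def)
    next
      case 2
      then have V2: "form_fun 2 V VC" using V by simp
      then have "quadratic_form V" using form_fun_low_degree[OF V2] by simp
      then obtain b where b: "\<And>x y s. V (\<lambda>i. x i + s * y i) = V x + s * b x y + s\<^sup>2 * V y"
        using quadratic_form_line by metis
      have DV: "dir_deriv y V x = b x y" for x y
      proof -
        have "((\<lambda>s. V x + s * b x y + s\<^sup>2 * V y) has_field_derivative b x y) (at 0)"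
          by (auto intro!: derivative_eq_intros)
        then show ?thesis
          unfolding dir_deriv_def b by (rule DERIV_imp_deriv)
      qed
      show ?thesis
      proof (rule quadratic[OF nonneg])
        fix x0 :: "nat \<Rightarrow> real" assume x0: "x0 \<in> vecs m" "eval q x0 > (0::real)"
        define y0 where "y0 = eval_map \<phi> x0"
        have y0: "V y0 > 0" "y0 \<in> vecs n" using x0 W \<phi>_vecs by (auto simp: y0_def)
        have "form_fun 2 (\<lambda>x. b (eval_map \<phi> x) y0) (\<lambda>z. cdir_deriv y0 VC (\<lambda>i. eval (\<phi> i) z))"
          using form_fun_comp[OF form_fun_dir_deriv[OF V2, of y0] \<Phi>] 2 by (simp add: DV)
        moreover have "b y0 y0 = 2 * V y0"
        proof -
          have "V (\<lambda>i. 2 * y0 i) = 4 * V y0"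
            using form_fun_homogeneous(1)[OF V2, of 2 y0] by simp
          then show ?thesis using b[of y0 1 y0] by simp
        qed
        moreover have "(b y y0)\<^sup>2 \<le> 4 * V y0 * V y" if "y \<in> vecs n" for y
        proof -
          have "(\<lambda>i. y i + (- b y y0 / (2 * V y0)) * y0 i) \<in> vecs n"
            using that y0 by (auto simp: vecs_def)
          from V_nonneg[OF this]
          have "0 \<le> V y + (- b y y0 / (2 * V y0)) * b y y0 + (- b y y0 / (2 * V y0))\<^sup>2 * V y0"
            unfolding b .
          also have "\<dots> = V y - (b y y0)\<^sup>2 / (4 * V y0)"
            using y0 by (simp add: field_simps power2_eq_square)
          finally show ?thesis using y0 by (simp add: field_simps)
        qed
        ultimately show "\<exists>g G. form_fun 2 g G \<and> g x0 = 2 * eval q x0 \<and>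
          (\<forall>x\<in>vecs m. (g x)\<^sup>2 \<le> 4 * eval q x0 * eval q x)"
          using \<phi>_vecs W x0(1) unfolding y0_def
          by (intro exI[of _ "\<lambda>x. b (eval_map \<phi> x) (eval_map \<phi> x0)"]
              exI[of _ "\<lambda>z. cdir_deriv (eval_map \<phi> x0) VC (\<lambda>i. eval (\<phi> i) z)"] conjI ballI)
            simp_all
      qed
    qed
  qed
qed

text \<open>
  A hyperwron that is bounded by the determinant is a multiple \<open>c\<close> of it by extremality, and both of the forms that a
  non-zero hyperwron can take contradict \<open>qdet_not_product_on_hyperplane\<close>.
\<close>
lemma hyperwron_below_qdet_vanishes:
  assumes q: "q \<in> hyperwrons 16 2"
    and bound: "\<And>x y z w. eval q (mat_vec x y z w) \<le> qdet x y z w"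
  shows "eval q (mat_vec 1 0 0 1) = (0::real)"
proof (rule ccontr)
  assume nz: "eval q (mat_vec 1 0 0 1) \<noteq> (0::real)"
  define c :: real where "c = eval q (mat_vec 1 0 0 1)"
  have qf: "form_fun 4 (eval q) (eval q)"
    using q form_fun_eval[of q 16 "2 * 2"] by (simp add: hyperwrons_def)
  have ext: "eval q (mat_vec x y z w) = c * qdet x y z w" if "\<And>x. x \<in> vecs 16 \<Longrightarrow> eval q x \<ge> (0::real)" for x y z w
    unfolding c_def by (rule qdet_extremal[OF qf, of 1]) (use that bound in auto)
  from q show False
  proof (cases rule: hyperwron_structure)
    case zero
    then show ?thesis using nz by simp
  next
    case quadratic
    have "c > 0" using quadratic(1)[of "mat_vec 1 0 0 1"] nz by (simp add: c_def)
    then obtain g G where g: "form_fun 2 g G" "g (mat_vec 1 0 0 1) = 2 * c"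
      "\<And>x. x \<in> vecs 16 \<Longrightarrow> (g x)\<^sup>2 \<le> 4 * c * eval q x"
      using quadratic(2)[of "mat_vec 1 0 0 1"] by (auto simp: c_def)
    have "(g (mat_vec x y z w))\<^sup>2 = (g (mat_vec 1 0 0 1))\<^sup>2 * qdet x y z w" for x y z w
    proof (rule qdet_extremal[of "\<lambda>x. (g x)\<^sup>2"])
      show "form_fun 4 (\<lambda>x. (g x)\<^sup>2) (\<lambda>z. (G z)\<^sup>2)"
        using form_fun_power[OF g(1), of 2] by simp
      show "(g (mat_vec x y z w))\<^sup>2 \<le> 4 * c\<^sup>2 * qdet x y z w" for x y z w
        using g(3)[of "mat_vec x y z w"] by (simp add: ext[OF quadratic(1)] power2_eq_square mult.assoc)
    qed simp
    then have "g (mat_vec x y z w) * g (mat_vec x y z w) = (2 * c)\<^sup>2 * qdet x y z w" for x y z w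
      by (simp add: g(2) power2_eq_square)
    moreover have "quadratic_form g" using form_fun_low_degree[OF g(1)] by simp
    moreover have "linear_form (\<lambda>x. 0)" by (simp add: linear_form_def)
    ultimately show False
      using qdet_not_product_on_hyperplane[of g g "\<lambda>x. 0" "(2 * c)\<^sup>2"] \<open>c > 0\<close> by simp
  next
    case (cubic B C D)
    have "c > 0" using cubic(1)[of "mat_vec 1 0 0 1"] nz by (simp add: c_def)
    then show False
      using qdet_not_product_on_hyperplane[OF cubic(2-4)] cubic(5) ext[OF cubic(1)] by (metis mat_vec_in_vecs)
  qed
qed

text \<open>Evaluation of the components commutes with the quaternion operations, which identifies the quartic with \<open>qdet\<close>.\<close>
abbreviation eval_quat :: "real_mpoly quat \<Rightarrow> (nat \<Rightarrow> real) \<Rightarrow> real quat" where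
  "eval_quat q v \<equiv> map_quat (\<lambda>p. eval p v) q"

lemma eval_quat_simps:
  "eval_quat (p + q) v = eval_quat p v + eval_quat q v"
  "eval_quat (p * q) v = eval_quat p v * eval_quat q v"
  "eval_quat (qconj q) v = qconj (eval_quat q v)"
  "eval (qnorm2 q) v = qnorm2 (eval_quat q v)"
  by (cases p; cases q; simp add: power2_eq_square)+

lemma eval_quat_var:
  "eval_quat (quat_var 0) (mat_vec x y z w) = x"
  "eval_quat (quat_var 1) (mat_vec x y z w) = y"
  "eval_quat (quat_var 2) (mat_vec x y z w) = z"
  "eval_quat (quat_var 3) (mat_vec x y z w) = w"
  by (cases x; cases y; cases z; cases w; simp add: quat_var_def mat_vec_def)+

theorem theorem1p2:
  fixes x y z w :: "real_mpoly quat"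
  assumes "x = quat_var 0" and "y = quat_var 1" and "z = quat_var 2" and "w = quat_var 3"
  shows "\<not> (\<exists>(N::nat) h. (\<forall>j<N. h j \<in> hyperwrons 16 2) \<and>
    (qnorm2 x + qnorm2 y) * (qnorm2 z + qnorm2 w) - qnorm2 (x * qconj z + y * qconj w)
      = (\<Sum>j<N. h j))"
proof
  assume "\<exists>(N::nat) h. (\<forall>j<N. h j \<in> hyperwrons 16 2) \<and>
    (qnorm2 x + qnorm2 y) * (qnorm2 z + qnorm2 w) - qnorm2 (x * qconj z + y * qconj w)
      = (\<Sum>j<N. h j)"
  then obtain N :: nat and h where "\<forall>j<N. h j \<in> hyperwrons 16 2"
    and sum: "(qnorm2 x + qnorm2 y) * (qnorm2 z + qnorm2 w) - qnorm2 (x * qconj z + y * qconj w) = (\<Sum>j<N. h j)"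
    by blast
  then have h: "h j \<in> hyperwrons 16 2" if "j < N" for j
    using that by blast
  have qdet: "qdet a b c d = (\<Sum>j<N. eval (h j) (mat_vec a b c d))" for a b c d
  proof -
    have "(\<Sum>j<N. eval (h j) (mat_vec a b c d))
      = eval ((qnorm2 x + qnorm2 y) * (qnorm2 z + qnorm2 w) - qnorm2 (x * qconj z + y * qconj w)) (mat_vec a b c d)"
      unfolding sum eval_sum ..
    also have "\<dots> = qdet a b c d"
      by (simp only: eval_quat_simps eval_quat_var assms qdet_def eval_diff eval_mult eval_add)
    finally show ?thesis ..
  qed
  have nonneg: "eval (h j) v \<ge> (0::real)" if "j < N" "v \<in> vecs 16" for j v
    using h[OF that(1)] by (cases rule: hyperwron_structure) (use that(2) in auto)
  have "eval (h j) (mat_vec a b c d) \<le> qdet a b c d" if "j < N" for j a b c d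
    unfolding qdet by (rule member_le_sum) (use that nonneg in auto)
  then have "eval (h j) (mat_vec 1 0 0 1) = (0::real)" if "j < N" for j
    using hyperwron_below_qdet_vanishes[OF h] that by blast
  then have "qdet 1 0 0 1 = (0::real)"
    unfolding qdet by simp
  then show False by (simp add: qdet_diag)
qed

end
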